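(* $r$-\textsc{Grouped Dominating Set} can be solved in $O^*(\Delta^{O(kr^2)})$ time, where $\Delta$ is the maximum degree of the input graph.
   Context: Let $G=(V,E)$ be a finite undirected graph. An $r$-grouped dominating set with $k$ units in $G$ is a family $\mathcal{D}=\{D_1,\dots,D_k\}$ of mutually disjoint subsets of $V$ such that $|D_i|=r$ and the induced subgraph $G[D_i]$ is connected for each $i$, and $\bigcup_i D_i$ is a dominating set of $G$. The problem $r$-\textsc{Grouped Dominating Set} takes as input a graph $G$ and positive integers $r$ and $k$, and asks whether $G$ has an $r$-grouped dominating set with at most $k$ units. The notation $O^*(\cdot)$ suppresses factors polynomial in the input size. *)

theory Defs
  imports
    "Graph_Theory.Graph_Theory"
    "HOL-Library.Disjoint_Sets"
    "HOL-Library.Log_Nat"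
begin

section \<open>The problem\<close>

text \<open>
  A finite simple undirected graph is a \<open>pair_graph\<close>: a finite vertex set with a symmetric
  irreflexive set of arcs, every edge being represented by its two orientations.
\<close>

definition dominating_set :: "'a pair_pre_digraph \<Rightarrow> 'a set \<Rightarrow> bool" where
  "dominating_set G S \<longleftrightarrow>
     S \<subseteq> pverts G \<and> (\<forall>v \<in> pverts G - S. \<exists>u \<in> S. (u, v) \<in> parcs G)"

text \<open>
  For \<open>r > 0\<close> disjoint units are pairwise distinct, so a set of sets loses nothing against an
  indexed family.
\<close>

definition grouped_dominating_set ::
    "nat \<Rightarrow> nat \<Rightarrow> 'a pair_pre_digraph \<Rightarrow> 'a set set \<Rightarrow> bool" where
  "grouped_dominating_set r k G \<D> \<longleftrightarrow>
     finite \<D> \<and> card \<D> = k \<and> disjoint \<D> \<and>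
     (\<forall>D \<in> \<D>. D \<subseteq> pverts G \<and> card D = r \<and>
        Digraph_Component.connected (with_proj G \<restriction> D)) \<and>
     dominating_set G (\<Union>\<D>)"

definition r_grouped_dominating_set_problem :: "'a pair_pre_digraph \<Rightarrow> nat \<Rightarrow> nat \<Rightarrow> bool" where
  "r_grouped_dominating_set_problem G r k \<longleftrightarrow>
     (\<exists>j \<le> k. \<exists>\<D>. grouped_dominating_set r j G \<D>)"

text \<open>Edges occur in both orientations, so the out-degree is the undirected degree.\<close>

definition max_degree :: "'a pair_pre_digraph \<Rightarrow> nat" where
  "max_degree G = Max (insert 0 (out_degree (with_proj G) ` pverts G))"


section \<open>The machine model\<close>

text \<open>
  A random access machine in structured form. The memory is an unbounded array of natural numbers,
  initially zero and addressed indirectly; the input is a separate read-only array (reading beyond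
  its end yields \<open>0\<close>). The arithmetic operations are addition and truncated subtraction.
  Each operation costs one unit. Multiplication is deliberately not primitive: in \<open>t\<close> steps numbers
  then grow by at most \<open>t\<close> bits, so that this time measure is polynomially related to Turing
  machine time.
\<close>

datatype exp =
    Const nat
  | Inp exp
  | Mem exp
  | Add exp exp
  | Sub exp exp

datatype prog =
    Skip
  | Assign exp exp
  | Seq prog prog
  | Cond exp prog prog
  | While exp prog

type_synonym memory = "nat \<Rightarrow> nat"

primrec eval :: "nat list \<Rightarrow> memory \<Rightarrow> exp \<Rightarrow> nat" where
  "eval x m (Const n) = n"
| "eval x m (Inp e) = (if eval x m e < length x then x ! eval x m e else 0)"
| "eval x m (Mem e) = m (eval x m e)"
| "eval x m (Add e e') = eval x m e + eval x m e'"
| "eval x m (Sub e e') = eval x m e - eval x m e'"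

primrec eval_cost :: "exp \<Rightarrow> nat" where
  "eval_cost (Const n) = 1"
| "eval_cost (Inp e) = 1 + eval_cost e"
| "eval_cost (Mem e) = 1 + eval_cost e"
| "eval_cost (Add e e') = 1 + eval_cost e + eval_cost e'"
| "eval_cost (Sub e e') = 1 + eval_cost e + eval_cost e'"

text \<open>
  \<open>exec x c m t m'\<close>: on input \<open>x\<close>, program \<open>c\<close> started in memory \<open>m\<close> halts after exactly \<open>t\<close> time
  units in memory \<open>m'\<close>. The first argument of \<open>Assign\<close> is the target address; tests succeed on
  nonzero values.
\<close>

inductive exec :: "nat list \<Rightarrow> prog \<Rightarrow> memory \<Rightarrow> nat \<Rightarrow> memory \<Rightarrow> bool" for x where
  Skip: "exec x Skip m 1 m"
| Assign: "exec x (Assign a e) m (1 + eval_cost a + eval_cost e) (m(eval x m a := eval x m e))"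
| Seq: "exec x c m t m' \<Longrightarrow> exec x c' m' t' m'' \<Longrightarrow> exec x (Seq c c') m (t + t') m''"
| CondT: "eval x m e \<noteq> 0 \<Longrightarrow> exec x c m t m' \<Longrightarrow>
    exec x (Cond e c c') m (1 + eval_cost e + t) m'"
| CondF: "eval x m e = 0 \<Longrightarrow> exec x c' m t m' \<Longrightarrow>
    exec x (Cond e c c') m (1 + eval_cost e + t) m'"
| WhileF: "eval x m e = 0 \<Longrightarrow> exec x (While e c) m (1 + eval_cost e) m"
| WhileT: "eval x m e \<noteq> 0 \<Longrightarrow> exec x c m t m' \<Longrightarrow> exec x (While e c) m' t' m'' \<Longrightarrow>
    exec x (While e c) m (1 + eval_cost e + t + t') m''"

inductive_cases exec_SkipE: "exec x Skip m t m'"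
inductive_cases exec_AssignE: "exec x (Assign a e) m t m'"
inductive_cases exec_SeqE: "exec x (Seq c c') m t m'"
inductive_cases exec_CondE: "exec x (Cond e c c') m t m'"
inductive_cases exec_WhileE: "exec x (While e c) m t m'"

text \<open>Hence the existential quantifiers in \<open>decides_within\<close> below pick out the unique run.\<close>

lemma exec_deterministic:
  "exec x c m t m' \<Longrightarrow> exec x c m u m'' \<Longrightarrow> u = t \<and> m'' = m'"
proof (induction arbitrary: u m'' rule: exec.induct)
  case (Skip m)
  then show ?case by (auto elim!: exec_SkipE)
next
  case (Assign a e m)
  then show ?case by (auto elim!: exec_AssignE)
next
  case (Seq c m t m' c' t' m3)
  from Seq.prems show ?case
    by (rule exec_SeqE) (auto dest!: Seq.IH)
next
  case (CondT m e c t m' c')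
  from CondT.prems show ?case
    by (rule exec_CondE) (use CondT.hyps in \<open>auto dest!: CondT.IH\<close>)
next
  case (CondF m e c' t m' c)
  from CondF.prems show ?case
    by (rule exec_CondE) (use CondF.hyps in \<open>auto dest!: CondF.IH\<close>)
next
  case (WhileF m e c)
  from WhileF.prems show ?case
    by (rule exec_WhileE) (use WhileF.hyps in auto)
next
  case (WhileT m e c t m' t' m3)
  from WhileT.prems show ?case
    by (rule exec_WhileE) (use WhileT.hyps in \<open>auto dest!: WhileT.IH\<close>)
qed

definition decides_within :: "prog \<Rightarrow> nat list \<Rightarrow> bool \<Rightarrow> nat \<Rightarrow> bool" where
  "decides_within c x answer T \<longleftrightarrow>
     (\<exists>t m. exec x c (\<lambda>_. 0) t m \<and> (m 0 \<noteq> 0 \<longleftrightarrow> answer) \<and> t \<le> T)"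


section \<open>Encoding of instances\<close>

text \<open>
  The number of vertices, \<open>r\<close>, \<open>k\<close>, and the adjacency matrix with respect to an enumeration \<open>vs\<close> of
  the vertices, row by row.
\<close>

definition encode :: "'a pair_pre_digraph \<Rightarrow> 'a list \<Rightarrow> nat \<Rightarrow> nat \<Rightarrow> nat list" where
  "encode G vs r k =
     [length vs, r, k] @ concat (map (\<lambda>u. map (\<lambda>v. if (u, v) \<in> parcs G then 1 else 0) vs) vs)"

text \<open>
  Input words are measured in binary, plus one symbol per word as a separator; in particular \<open>r\<close>
  and \<open>k\<close> contribute only logarithmically.
\<close>

definition input_size :: "nat list \<Rightarrow> nat" where
  "input_size x = (\<Sum>w\<leftarrow>x. floorlog 2 w + 1)"

end

theory Submission
  imports Defs
begin

text \<open>
  A bounded search tree. While some vertex \<open>v\<close> is undominated, a further unit must meet the closed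
  neighbourhood of \<open>v\<close>, and it can be grown vertex by vertex from there. A connected set of fewer
  than \<open>r\<close> vertices has at most \<open>1 + r (\<Delta> - 1) \<le> \<Delta> ^ r\<close> outer neighbours, so each step branches into
  at most \<open>\<Delta> ^ (2 * r)\<close> states, and there are at most \<open>min n (k * r)\<close> steps. The program explores the
  tree breadth first with a queue, spending quadratic time per state.
\<close>

section \<open>Growing connected sets\<close>

text \<open>For \<open>\<Delta> = 1\<close> the claimed bound is a plain polynomial, so not even a
  constant factor per step can be hidden in the exponent: such graphs must not branch at all. This
  rules out the crude estimate \<open>r * \<Delta>\<close> for the boundary of a unit, and also
  trying all \<open>\<Delta> + 1\<close> vertices of a closed neighbourhood. Hence the sharper
  boundary count and the exchange of a leaf for its neighbour. The depth is capped by
  \<open>n\<close> as well as by \<open>k * r\<close> because \<open>r\<close> and \<open>k\<close>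
  are written in binary: a factor \<open>k * r\<close> in the number of levels would not be
  polynomial in the input size.\<close>

lemma bernoulli_nat: "1 + r * (d - 1) \<le> d ^ r" if "d \<ge> 1" for d r :: nat
proof (induction r)
  case (Suc r)
  have "1 + Suc r * (d - 1) \<le> d * (1 + r * (d - 1))"
    using that by (cases d) (auto simp: algebra_simps)
  also have "\<dots> \<le> d ^ Suc r" unfolding power_Suc using Suc by (rule mult_le_mono2)
  finally show ?case .
qed simp

context pair_graph begin

text \<open>Connected sets in the form in which the search produces them; the boundary count follows
  this order of insertion.\<close>

inductive grown :: "'a set \<Rightarrow> bool" where
  single: "v \<in> pverts G \<Longrightarrow> grown {v}"
| grow: "grown U \<Longrightarrow> x \<in> U \<Longrightarrow> (x, y) \<in> parcs G \<Longrightarrow> y \<notin> U \<Longrightarrow> grown (insert y U)"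

definition boundary :: "'a set \<Rightarrow> 'a set" where
  "boundary U = {y. y \<notin> U \<and> (\<exists>x \<in> U. (x, y) \<in> parcs G)}"

abbreviation nbrs :: "'a \<Rightarrow> 'a set" where
  "nbrs v \<equiv> {y. (v, y) \<in> parcs G}"

lemma arc_sym: "(u, v) \<in> parcs G \<longleftrightarrow> (v, u) \<in> parcs G"
  using sym_arcs arcs_ends_symmetric by (auto simp: symmetric_def elim: symE)

lemma no_loop: "(u, u) \<notin> parcs G"
  using no_loops' by blast

lemma nbrs_subset: "nbrs v \<subseteq> pverts G"
  by (auto dest: in_arcsD2)

lemma finite_nbrs: "finite (nbrs v)"
  using nbrs_subset finite_verts finite_subset by fastforce

lemma card_nbrs_le: "card (nbrs v) \<le> max_degree G"
proof (cases "v \<in> pverts G")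
  case True
  have "out_arcs (with_proj G) v = Pair v ` nbrs v" by (auto simp: out_arcs_def)
  hence "out_degree (with_proj G) v = card (nbrs v)"
    by (simp add: out_degree_def card_image inj_on_def)
  then show ?thesis
    unfolding max_degree_def using True finite_verts by (metis Max_ge finite_imageI finite_insert imageI insertI2 with_proj_simps(1))
next
  case False
  hence "nbrs v = {}" by (auto dest: in_arcsD1)
  then show ?thesis by simp
qed

lemma grown_subset: "grown U \<Longrightarrow> U \<subseteq> pverts G"
  by (induction rule: grown.induct) (auto dest: in_arcsD2)

lemma grown_finite: "grown U \<Longrightarrow> finite U"
  by (induction rule: grown.induct) auto

lemma grown_nonempty: "grown U \<Longrightarrow> U \<noteq> {}"
  by (induction rule: grown.induct) auto

text \<open>Connectedness is strong connectedness of the symmetric closure, and closing adds nothing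
  here since arcs already come in both directions.\<close>

lemma connected_induced_iff:
  assumes "D \<subseteq> pverts G"
  shows "connected (with_proj G \<restriction> D) \<longleftrightarrow>
    D \<noteq> {} \<and> (\<forall>u \<in> D. \<forall>v \<in> D. (u, v) \<in> rtrancl_on D (parcs G \<inter> D \<times> D))"
proof -
  have "parcs (mk_symmetric (with_proj G \<restriction> D)) = parcs G \<inter> D \<times> D"
    using arc_sym by (auto simp: parcs_mk_symmetric)
  thus ?thesis
    by (simp add: connected_def strongly_connected_def reachable_def)
qed

lemma grown_connected:
  assumes "grown U" shows "connected (with_proj G \<restriction> U)"
proof -
  have "\<forall>u \<in> U. \<forall>v \<in> U. (u, v) \<in> rtrancl_on U (parcs G \<inter> U \<times> U)"
    using assms
  proof (induction rule: grown.induct)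
    case (single v)
    then show ?case by (auto)
  next
    case (grow U x y)
    let ?U = "insert y U" let ?R = "rtrancl_on ?U (parcs G \<inter> ?U \<times> ?U)"
    have old: "(u, v) \<in> ?R" if "u \<in> U" "v \<in> U" for u v
      using grow.IH that rtrancl_on_mono[of "parcs G \<inter> U \<times> U" "parcs G \<inter> ?U \<times> ?U" U ?U] by blast
    have xy: "(x, y) \<in> ?R" "(y, x) \<in> ?R"
      using grow.hyps(2,3) arc_sym
      by (auto intro!: rtrancl_on_into_rtrancl_on[of x x] rtrancl_on_into_rtrancl_on[of y y])
    have yy: "(y, y) \<in> ?R" by simp
    have "(u, y) \<in> ?R" "(y, u) \<in> ?R" if "u \<in> U" for u
      using old[OF that \<open>x \<in> U\<close>] old[OF \<open>x \<in> U\<close> that] xy rtrancl_on_trans by metis+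
    thus ?case using old yy by blast
  qed
  thus ?thesis
    using connected_induced_iff[OF grown_subset[OF assms]] grown_nonempty[OF assms] by simp
qed

text \<open>A walk from \<open>U\<close> to the rest of \<open>D\<close> leaves \<open>U\<close>
  somewhere. Thus a proper part of a solution's unit can always grow inside that unit.\<close>

lemma connected_crossing:
  assumes "connected (with_proj G \<restriction> D)" "D \<subseteq> pverts G" "U \<subseteq> D" "U \<noteq> {}" "U \<noteq> D"
  obtains x y where "x \<in> U" "y \<in> D" "y \<notin> U" "(x, y) \<in> parcs G"
proof -
  obtain u v where uv: "u \<in> U" "v \<in> D" "v \<notin> U" using assms by blast
  hence "(u, v) \<in> rtrancl_on D (parcs G \<inter> D \<times> D)"
    using assms(1,3) connected_induced_iff[OF assms(2)] by blast
  hence "v \<in> U \<or> (\<exists>x y. x \<in> U \<and> y \<in> D \<and> y \<notin> U \<and> (x, y) \<in> parcs G)"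
    using uv(1) by (induction rule: rtrancl_on_induct) auto
  thus thesis using uv that by blast
qed

text \<open>The maximum with 1 covers edgeless graphs, where powers of the degree would
  vanish.\<close>

abbreviation deg_bound :: nat ("\<Delta>") where
  "\<Delta> \<equiv> max 1 (max_degree G)"

lemma finite_boundary: "finite (boundary U)"
proof (rule finite_subset)
  show "boundary U \<subseteq> pverts G" by (auto simp: boundary_def dest: in_arcsD2)
qed (rule finite_verts)

text \<open>Each added vertex uses up one boundary vertex and has a neighbour inside already, so it
  contributes at most \<open>\<Delta> - 1\<close> new ones; for \<open>\<Delta> = 1\<close> there is never a choice.\<close>

lemma grown_boundary: "grown U \<Longrightarrow> card (boundary U) \<le> 1 + card U * (\<Delta> - 1)"
proof (induction rule: grown.induct)
  case (single v)
  have "boundary {v} = nbrs v" using no_loop by (auto simp: boundary_def)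
  thus ?case using card_nbrs_le[of v] by simp
next
  case (grow U x y)
  have yb: "y \<in> boundary U" using grow.hyps by (auto simp: boundary_def)
  have sub: "boundary (insert y U) \<subseteq> (boundary U - {y}) \<union> (nbrs y - {x})"
    using grow.hyps by (auto simp: boundary_def)
  have "card (nbrs y - {x}) = card (nbrs y) - 1"
    using arc_sym grow.hyps finite_nbrs by simp
  hence 1: "card (nbrs y - {x}) \<le> \<Delta> - 1" using card_nbrs_le[of y] by linarith
  have 2: "card (boundary U - {y}) = card (boundary U) - 1"
    using yb finite_boundary by simp
  have 3: "card (boundary U) > 0" using yb finite_boundary card_gt_0_iff by blast
  have "card (boundary (insert y U)) \<le> card ((boundary U - {y}) \<union> (nbrs y - {x}))"
    using sub by (rule card_mono[rotated]) (simp add: finite_boundary finite_nbrs)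
  also have "\<dots> \<le> card (boundary U) - 1 + (\<Delta> - 1)"
    using card_Un_le[of "boundary U - {y}" "nbrs y - {x}"] 1 2 by linarith
  also have "\<dots> \<le> card U * (\<Delta> - 1) + (\<Delta> - 1)" using grow.IH 3 by linarith
  finally show ?case using grow.hyps grown_finite by simp
qed

end

section \<open>The search space\<close>

locale unit_search = pair_graph G for G :: "'a pair_pre_digraph" +
  fixes vs :: "'a list" and r k :: nat
  assumes distinct_vs: "distinct vs" and set_vs: "set vs = pverts G" and r_pos: "r > 0"
begin

abbreviation "n \<equiv> length vs"

abbreviation adj :: "nat \<Rightarrow> nat \<Rightarrow> bool" where
  "adj x w \<equiv> (vs ! x, vs ! w) \<in> parcs G"

definition cls :: "(nat \<Rightarrow> nat) \<Rightarrow> nat \<Rightarrow> 'a set" where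
  "cls f i = (!) vs ` {w. w < n \<and> f w = i}"

definition used :: "(nat \<Rightarrow> nat) \<Rightarrow> nat" where
  "used f = card {w. w < n \<and> f w \<noteq> 0}"

text \<open>
  A search state \<open>(f, j, s)\<close> labels each vertex index with the number of its unit, \<open>0\<close> meaning
  unused. Units \<open>1, \<dots>, j - 1\<close> are complete and unit \<open>j\<close> still lacks \<open>s\<close> vertices; the initial state
  has \<open>j = s = 0\<close> and is all zero, like fresh memory.
\<close>

definition valid :: "(nat \<Rightarrow> nat) \<times> nat \<times> nat \<Rightarrow> bool" where
  "valid = (\<lambda>(f, j, s). j \<le> k \<and> (j = 0 \<longrightarrow> s = 0) \<and> (\<forall>w < n. f w \<le> j) \<and>
     (\<forall>i \<in> {1..j}. grown (cls f i) \<and> card (cls f i) + (if i = j then s else 0) = r) \<and>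
     used f + s = j * r)"

definition undominated :: "(nat \<Rightarrow> nat) \<Rightarrow> nat \<Rightarrow> bool" where
  "undominated f w \<longleftrightarrow> w < n \<and> f w = 0 \<and> \<not> (\<exists>x < n. f x \<noteq> 0 \<and> adj x w)"

text \<open>The number \<open>i\<close> of units is left free because exchanging a leaf may merge
  two units.\<close>

definition good :: "(nat \<Rightarrow> nat) \<times> nat \<times> nat \<Rightarrow> bool" where
  "good = (\<lambda>(f, j, s). \<exists>i \<le> k. \<exists>\<D>. grouped_dominating_set r i G \<D> \<and>
     (\<forall>i \<in> {1..j}. \<exists>D \<in> \<D>. cls f i \<subseteq> D))"

text \<open>
  With \<open>v = n\<close> the candidates extend unit \<open>j\<close>; with \<open>v < n\<close> undominated and unit \<open>j\<close> still empty
  they start a unit that dominates \<open>v\<close>. In the latter case \<open>v\<close> itself is a choice unless it has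
  exactly one neighbour: this keeps the branching trivial when the maximum degree is \<open>1\<close>.
\<close>

definition cand :: "nat \<Rightarrow> (nat \<Rightarrow> nat) \<Rightarrow> nat \<Rightarrow> nat \<Rightarrow> bool" where
  "cand v f j w \<longleftrightarrow> f w = 0 \<and> (\<exists>x < n. (x = v \<or> f x = j) \<and> adj x w)"

definition child :: "(nat \<Rightarrow> nat) \<Rightarrow> nat \<Rightarrow> nat \<Rightarrow> nat \<Rightarrow> (nat \<Rightarrow> nat) \<times> nat \<times> nat" where
  "child f j s w = (f(w := j), j, s - 1)"

definition choices :: "nat \<Rightarrow> (nat \<Rightarrow> nat) \<Rightarrow> nat \<Rightarrow> nat list" where
  "choices v f j = (let ws = filter (cand v f j) [0..<n]
     in if v < n \<and> length ws \<noteq> 1 then ws @ [v] else ws)"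

section \<open>Labels and their vertex classes\<close>

lemma nth_inj: "x < n \<Longrightarrow> y < n \<Longrightarrow> vs ! x = vs ! y \<longleftrightarrow> x = y"
  using distinct_vs nth_eq_iff_index_eq by blast

lemma vert_index:
  assumes "u \<in> pverts G" obtains w where "w < n" "vs ! w = u"
  using assms set_vs by (metis in_set_conv_nth)

lemma nth_vert: "w < n \<Longrightarrow> vs ! w \<in> pverts G"
  using set_vs nth_mem by blast

lemma in_cls_iff: "w < n \<Longrightarrow> vs ! w \<in> cls f i \<longleftrightarrow> f w = i"
  unfolding cls_def using nth_inj by blast

lemma cls_subset: "cls f i \<subseteq> pverts G"
  using nth_vert by (auto simp: cls_def)

lemma cls_upd_same:
  assumes "w < n" shows "cls (f(w := i)) i = insert (vs ! w) (cls f i)"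
proof -
  have "{x. x < n \<and> (f(w := i)) x = i} = insert w {x. x < n \<and> f x = i}" using assms by auto
  thus ?thesis by (simp add: cls_def)
qed

lemma cls_upd_other:
  assumes "f w = 0" "i \<noteq> j" "j \<noteq> 0" shows "cls (f(w := i)) j = cls f j"
proof -
  have "{x. x < n \<and> (f(w := i)) x = j} = {x. x < n \<and> f x = j}" using assms by auto
  thus ?thesis by (simp add: cls_def)
qed

lemma cls_disjoint: "i \<noteq> j \<Longrightarrow> cls f i \<inter> cls f j = {}"
  using nth_inj by (fastforce simp: cls_def)

lemma used_upd:
  assumes "w < n" "f w = 0" "i \<noteq> 0" shows "used (f(w := i)) = Suc (used f)"
proof -
  have "{x. x < n \<and> (f(w := i)) x \<noteq> 0} = insert w {x. x < n \<and> f x \<noteq> 0}" using assms by auto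
  thus ?thesis using assms by (simp add: used_def)
qed

lemma used_le: "used f \<le> n"
proof -
  have "used f \<le> card {..<n}" unfolding used_def by (rule card_mono) auto
  thus ?thesis by simp
qed

text \<open>Each step labels one further vertex, so this bounds the depth of the search
  tree.\<close>

lemma valid_used_le:
  assumes "valid (f, j, s)" shows "used f \<le> min n (k * r)"
proof -
  have "used f + s = j * r" "j \<le> k" using assms by (auto simp: valid_def)
  hence "used f \<le> k * r" using mult_le_mono1[of j k r] by linarith
  thus ?thesis using used_le by simp
qed

section \<open>Children of a state: validity and number\<close>

lemma valid_child_grow:
  assumes V: "valid (f, j, s)" and s: "s > 0" and w: "w < n" "f w = 0"
    and x: "x < n" "f x = j" "adj x w"
  shows "valid (child f j s w)"
proof -
  have j: "j > 0" using V s by (auto simp: valid_def)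
  have wj: "vs ! w \<notin> cls f j" using w j in_cls_iff by simp
  have "grown (insert (vs ! w) (cls f j))"
    using V j x wj by (intro grow[of _ "vs ! x"]) (auto simp: valid_def in_cls_iff)
  moreover have "card (insert (vs ! w) (cls f j)) = Suc (card (cls f j))"
    using V j wj grown_finite by (auto simp: valid_def)
  ultimately show ?thesis using V j s w used_upd[of w f j]
    by (auto simp: valid_def child_def cls_upd_same cls_upd_other)
qed

text \<open>Passing \<open>r\<close> makes \<open>child\<close> leave \<open>r - 1\<close>
  outstanding vertices, as the first one counts towards the new unit.\<close>

lemma valid_child_start:
  assumes V: "valid (f, j, 0)" and jk: "j < k" and w: "w < n" "f w = 0"
  shows "valid (child f (Suc j) r w)"
proof -
  have e: "cls f (Suc j) = {}" using V by (force simp: valid_def cls_def)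
  have "grown {vs ! w}" using w nth_vert single by blast
  thus ?thesis using V jk e w r_pos used_upd[of w f "Suc j"]
    by (auto simp: valid_def child_def cls_upd_same cls_upd_other)
qed

text \<open>With first argument \<open>n\<close> no vertex is appended, and distinct candidates are
  distinct boundary vertices of the unit. \<open>\<Delta> ^ r\<close> would do here; the exponent
  \<open>2 * r\<close> is common to both kinds of step.\<close>

lemma card_choices_grow:
  assumes V: "valid (f, j, s)" and s: "s > 0"
  shows "length (choices n f j) \<le> \<Delta> ^ (2 * r)"
proof -
  have j: "j > 0" using V s by (auto simp: valid_def)
  have G: "grown (cls f j)" "card (cls f j) \<le> r" using V j by (force simp: valid_def)+
  have "length (choices n f j) = card ((!) vs ` {w. w < n \<and> cand n f j w})"
    by (subst card_image) (auto simp: choices_def inj_on_def nth_inj length_filter_conv_card intro!: arg_cong[where f = card])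
  also have "\<dots> \<le> card (boundary (cls f j))"
    using j by (intro card_mono finite_boundary) (auto simp: boundary_def cand_def in_cls_iff  intro!: bexI[of _ "vs ! _"])
  also have "\<dots> \<le> 1 + r * (\<Delta> - 1)"
    using grown_boundary[OF G(1)] mult_le_mono1[OF G(2), of "\<Delta> - 1"] by linarith
  also have "\<dots> \<le> \<Delta> ^ r" by (rule bernoulli_nat) simp
  also have "\<dots> \<le> \<Delta> ^ (2 * r)" by (rule power_increasing) auto
  finally show ?thesis .
qed

text \<open>Unit \<open>j\<close> is still empty, so only \<open>v\<close> can offer candidates, and
  a labelled neighbour would dominate \<open>v\<close>.\<close>

lemma undominated_cand:
  assumes "undominated f v" and "\<forall>w < n. f w < j"
  shows "cand v f j w \<longleftrightarrow> f w = 0 \<and> adj v w" "w < n \<Longrightarrow> cand v f j w \<longleftrightarrow> adj v w"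
  using assms arc_sym by (auto simp: cand_def undominated_def)

text \<open>Lets the program recognise a leaf by counting candidates instead of computing a
  degree.\<close>

lemma cands_card:
  assumes "undominated f v" and "\<forall>w < n. f w < j"
  shows "length (filter (cand v f j) [0..<n]) = card (nbrs (vs ! v))"
proof -
  have "length (filter (cand v f j) [0..<n]) = card {w. w < n \<and> cand v f j w}"
    by (simp add: length_filter_conv_card cong: conj_cong)
  also have "\<dots> = card ((!) vs ` {w. w < n \<and> cand v f j w})"
    by (subst card_image) (auto simp: inj_on_def nth_inj)
  also have "(!) vs ` {w. w < n \<and> cand v f j w} = nbrs (vs ! v)"
  proof -
    have "u \<in> (!) vs ` {w. w < n \<and> adj v w}" if "(vs ! v, u) \<in> parcs G" for u
      using vert_index[of u] that in_arcsD2 by (metis (mono_tags, lifting) imageI mem_Collect_eq)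
    thus ?thesis using undominated_cand(2)[OF assms] by (auto)
  qed
  finally show ?thesis .
qed

text \<open>If \<open>v\<close> has at most one neighbour, exactly one choice remains:
  \<open>v\<close> when isolated, the neighbour when a leaf. Otherwise
  \<open>\<Delta> \<ge> 2\<close>, and then \<open>\<Delta> + 1\<close> is at most
  \<open>\<Delta> ^ 2\<close>.\<close>

lemma card_choices_start:
  assumes "undominated f v" and "\<forall>w < n. f w < j"
  shows "length (choices v f j) \<le> \<Delta> ^ (2 * r)"
proof (cases "card (nbrs (vs ! v)) \<le> 1")
  case True
  hence "length (choices v f j) \<le> 1" using cands_card[OF assms] by (auto simp: choices_def Let_def)
  thus ?thesis by (meson le_trans one_le_power max.cobounded1)
next
  case False
  have D: "\<Delta> \<ge> 2" "card (nbrs (vs ! v)) \<le> \<Delta>" using False card_nbrs_le[of "vs ! v"] by linarith+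
  have "length (choices v f j) \<le> \<Delta> + 1" using cands_card[OF assms] D by (auto simp: choices_def Let_def)
  also have "\<dots> \<le> 2 * \<Delta>" using D by simp
  also have "\<dots> \<le> \<Delta> ^ 2" using D by (simp only: power2_eq_square mult_le_mono1)
  also have "\<dots> \<le> \<Delta> ^ (2 * r)" using r_pos by (intro power_increasing) auto
  finally show ?thesis .
qed

lemma choices_start_iff:
  assumes "undominated f v" and "\<forall>w < n. f w < j"
  shows "w \<in> set (choices v f j) \<longleftrightarrow>
    w < n \<and> (adj v w \<or> (w = v \<and> card (nbrs (vs ! v)) \<noteq> 1))"
proof -
  have "v < n" using assms by (simp add: undominated_def)
  thus ?thesis using undominated_cand(2)[OF assms] cands_card[OF assms]
    by (auto simp: choices_def Let_def)
qed

section \<open>Completeness: good states have good children\<close>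

lemma gds_unitD:
  assumes "grouped_dominating_set r i G \<D>" "D \<in> \<D>"
  shows "D \<subseteq> pverts G" "finite D" "card D = r" "connected (with_proj G \<restriction> D)"
  using assms finite_verts finite_subset unfolding grouped_dominating_set_def by blast+

lemma gds_unit_unique:
  assumes "grouped_dominating_set r i G \<D>" "D \<in> \<D>" "D' \<in> \<D>" "x \<in> D" "x \<in> D'"
  shows "D = D'"
  using assms unfolding grouped_dominating_set_def disjoint_def by blast

text \<open>Once nothing is outstanding, containment becomes equality by cardinality.\<close>

lemma full_unit:
  assumes "valid (f, j, s)" "grouped_dominating_set r i G \<D>" "D \<in> \<D>" "cls f l \<subseteq> D"
    "l \<in> {1..j}" "l < j \<or> s = 0"
  shows "cls f l = D"
proof (rule card_subset_eq)
  have "card (cls f l) + (if l = j then s else 0) = r" using assms(1,5) unfolding valid_def by blast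
  thus "card (cls f l) = card D" using assms(6) gds_unitD(3)[OF assms(2,3)] by (simp split: if_splits)
qed (use assms(4) gds_unitD(2)[OF assms(2,3)] in auto)

text \<open>The same solution witnesses the child: its unit around the current class is larger than
  the class, so some arc leads to a further vertex of that unit.\<close>

lemma good_grow:
  assumes V: "valid (f, j, s)" and s: "s > 0" and g: "good (f, j, s)"
  shows "\<exists>w \<in> set (choices n f j). good (child f j s w)"
proof -
  have j: "j \<in> {1..j}" using V s by (auto simp: valid_def)
  obtain i \<D> where i: "i \<le> k" and \<D>: "grouped_dominating_set r i G \<D>"
    and ex: "\<forall>i \<in> {1..j}. \<exists>D \<in> \<D>. cls f i \<subseteq> D"
    using g by (auto simp: good_def)
  obtain D where D: "D \<in> \<D>" "cls f j \<subseteq> D" using ex j by blast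
  have gr: "grown (cls f j)" "card (cls f j) < r" using V j s by (force simp: valid_def)+
  have ne: "cls f j \<noteq> {}" using gr grown_nonempty by blast
  have "cls f j \<noteq> D" using gr gds_unitD[OF \<D> D(1)] by auto
  then obtain x y where xy: "x \<in> cls f j" "y \<in> D" "y \<notin> cls f j" "(x, y) \<in> parcs G"
    using connected_crossing[OF gds_unitD(4,1)[OF \<D> D(1)] D(2) ne] by metis
  obtain x' where x': "x' < n" "x = vs ! x'" using xy(1) by (auto simp: cls_def)
  obtain w where w: "w < n" "vs ! w = y" using vert_index[of y] xy in_arcsD2 by blast
  have wj: "f w \<noteq> j" using w xy in_cls_iff by blast
  \<comment> \<open>Another label would put \<open>y\<close> into a completed class, which is a unit
    of the solution. Disjointness of the units makes it \<open>D\<close>, yet \<open>D\<close>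
    contains the nonempty class \<open>j\<close>, which is disjoint from it.\<close>
  have "f w = 0"
  proof (rule ccontr)
    assume "f w \<noteq> 0"
    hence l: "f w \<in> {1..j}" "f w < j" using V w wj by (force simp: valid_def)+
    then obtain D' where D': "D' \<in> \<D>" "cls f (f w) \<subseteq> D'" using ex by blast
    have "y \<in> cls f (f w)" using w in_cls_iff by blast
    hence "D' = D" using gds_unit_unique[OF \<D> D'(1) D(1)] D' xy by blast
    hence "cls f (f w) = D" using full_unit[OF V \<D> D' l(1)] l by simp
    thus False using cls_disjoint[OF wj] D ne by blast
  qed
  hence "w \<in> set (choices n f j)" using w x' xy in_cls_iff
    by (auto simp: choices_def cand_def)
  moreover have "good (child f j s w)"
    unfolding good_def child_def prod.case
  proof (intro exI[of _ i] exI[of _ \<D>] conjI ballI)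
    fix l assume l: "l \<in> {1..j}"
    show "\<exists>D \<in> \<D>. cls (f(w := j)) l \<subseteq> D"
    proof (cases "l = j")
      case True
      thus ?thesis using D w xy by (auto simp: cls_upd_same)
    next
      case False
      thus ?thesis using cls_upd_other[of f w j l] \<open>f w = 0\<close> l ex by auto
    qed
  qed (use i \<D> in auto)
  ultimately show ?thesis by blast
qed

lemma inj_cls:
  assumes "valid (f, j, s)" shows "inj_on (cls f) {1..j}"
proof (rule inj_onI, rule ccontr)
  fix a b assume "a \<in> {1..j}" "b \<in> {1..j}" "cls f a = cls f b" "a \<noteq> b"
  moreover from this have "cls f a \<noteq> {}" using assms grown_nonempty unfolding valid_def by blast
  ultimately show False using cls_disjoint[of a b f] by auto
qed

text \<open>Justifies leaving out \<open>v\<close> itself in \<open>choices\<close>: a leaf may be dominated by its neighbour.\<close>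

lemma exchange_leaf:
  assumes \<D>: "grouped_dominating_set r i G \<D>" and D: "D \<in> \<D>" "y \<in> D"
    and leaf: "nbrs y = {u}"
  shows "\<exists>i' \<le> i. \<exists>\<D>' D'. grouped_dominating_set r i' G \<D>' \<and> D' \<in> \<D>' \<and> u \<in> D' \<and> \<D> - {D} \<subseteq> \<D>'"
proof (cases "r = 1")
  case True
  have "card D = 1" using gds_unitD(3)[OF \<D> D(1)] True by simp
  then obtain z where "D = {z}" by (rule card_1_singletonE)
  hence Dy: "D = {y}" using D(2) by simp
  have u: "u \<in> pverts G" "(y, u) \<in> parcs G" using leaf in_arcsD2 by blast+
  \<comment> \<open>\<open>{u}\<close> may already be a unit; then the number of units drops, hence
    only \<open>i' \<le> i\<close>. The vertices that \<open>y\<close> dominated are just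
    \<open>y\<close> and \<open>u\<close>, and \<open>{u}\<close> takes care of both.\<close>
  let ?\<D> = "insert {u} (\<D> - {D})"
  have sing: "\<exists>x. A = {x}" if "A \<in> ?\<D>" for A
  proof (cases "A = {u}")
    case False
    hence "card A = 1" using that gds_unitD(3)[OF \<D>, of A] True by blast
    thus ?thesis by (rule card_1_singletonE) blast
  qed blast
  have fin: "finite \<D>" "card \<D> = i" using \<D> by (auto simp: grouped_dominating_set_def)
  have "card ?\<D> \<le> Suc (card (\<D> - {D}))" using fin by (simp add: card_insert_if)
  also have "\<dots> = i" using card_Suc_Diff1[OF fin(1) D(1)] fin(2) by simp
  finally have c: "card ?\<D> \<le> i" .
  have "disjoint ?\<D>" unfolding disjoint_def
  proof (intro ballI impI)
    fix A B assume AB: "A \<in> ?\<D>" "B \<in> ?\<D>" "A \<noteq> B"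
    obtain a b where "A = {a}" "B = {b}" using sing[OF AB(1)] sing[OF AB(2)] by blast
    thus "A \<inter> B = {}" using AB(3) by simp
  qed
  moreover have "dominating_set G (\<Union>?\<D>)"
    unfolding dominating_set_def
  proof (intro conjI ballI)
    show "\<Union>?\<D> \<subseteq> pverts G" using u gds_unitD(1)[OF \<D>] by blast
    fix x assume x: "x \<in> pverts G - \<Union>?\<D>"
    have "x \<in> \<Union>\<D> \<or> (\<exists>z \<in> \<Union>\<D>. (z, x) \<in> parcs G)"
      using \<D> x unfolding grouped_dominating_set_def dominating_set_def by blast
    then consider "x \<in> D" | z where "z \<in> D" "(z, x) \<in> parcs G"
      | z where "z \<in> \<Union>(\<D> - {D})" "(z, x) \<in> parcs G" using x by blast
    thus "\<exists>z \<in> \<Union>?\<D>. (z, x) \<in> parcs G"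
    proof cases
      case 1
      thus ?thesis using Dy u(2) arc_sym by auto
    next
      case 2
      hence "x = u" using Dy leaf by auto
      thus ?thesis using x by simp
    next
      case 3
      thus ?thesis by blast
    qed
  qed
  moreover have "A \<subseteq> pverts G \<and> card A = r \<and> connected (with_proj G \<restriction> A)" if "A \<in> ?\<D>" for A
  proof (cases "A = {u}")
    case False
    hence "A \<in> \<D>" using that by simp
    thus ?thesis using gds_unitD[OF \<D>] by simp
  qed (use u True grown_connected[OF single[OF u(1)]] in simp)
  ultimately have "grouped_dominating_set r (card ?\<D>) G ?\<D>"
    using fin(1) unfolding grouped_dominating_set_def by (intro conjI ballI) simp_all
  thus ?thesis using c by (intro exI[of _ "card ?\<D>"] conjI exI[of _ ?\<D>] exI[of _ "{u}"]) auto
next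
  case False
  \<comment> \<open>A connected unit with a second vertex can leave \<open>y\<close> only through
    its sole neighbour, so it contains \<open>u\<close> already.\<close>
  have "{y} \<noteq> D" using False gds_unitD(3)[OF \<D> D(1)] by auto
  then obtain x z where "x \<in> {y}" "z \<in> D" "(x, z) \<in> parcs G"
    using connected_crossing[OF gds_unitD(4,1)[OF \<D> D(1)], of "{y}"] D(2)
    by (metis empty_subsetI insert_not_empty insert_subset)
  hence "u \<in> D" using leaf by auto
  thus ?thesis using \<D> D by (intro exI[of _ i] conjI exI[of _ \<D>] exI[of _ D]) auto
qed

text \<open>Completed classes are units of the solution and leave \<open>v\<close> undominated, so a
  dominator of \<open>v\<close> lies in a further unit. This leaves room for unit
  \<open>j + 1\<close>, and the dominator is its first vertex.\<close>

lemma good_start: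
  assumes V: "valid (f, j, 0)" and v: "undominated f v" and g: "good (f, j, 0)"
  shows "j < k" "\<exists>w \<in> set (choices v f (Suc j)). good (child f (Suc j) r w)"
proof -
  obtain i \<D> where i: "i \<le> k" and \<D>: "grouped_dominating_set r i G \<D>"
    and ex: "\<forall>i \<in> {1..j}. \<exists>D \<in> \<D>. cls f i \<subseteq> D"
    using g by (auto simp: good_def)
  have full: "cls f l \<in> \<D>" if l: "l \<in> {1..j}" for l
  proof -
    obtain D where "D \<in> \<D>" "cls f l \<subseteq> D" using ex l by blast
    thus ?thesis using full_unit[OF V \<D> _ _ l] by auto
  qed
  have lt: "\<forall>w < n. f w < Suc j" using V by (auto simp: valid_def)
  have vn: "v < n" using v by (simp add: undominated_def)
  let ?y = "vs ! v"
  have "?y \<in> \<Union>\<D> \<or> (\<exists>u \<in> \<Union>\<D>. (u, ?y) \<in> parcs G)"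
    using \<D> nth_vert[OF vn] unfolding grouped_dominating_set_def dominating_set_def by blast
  then obtain u D where u: "u \<in> D" "D \<in> \<D>" "u = ?y \<or> (u, ?y) \<in> parcs G" by blast
  have free: "f w = 0" if "w < n" "w = v \<or> adj w v" for w
    using v that by (auto simp: undominated_def)
  have notin: "a \<notin> cls f l" if "a = ?y \<or> (a, ?y) \<in> parcs G" "l \<in> {1..j}" for a l
  proof
    assume "a \<in> cls f l"
    then obtain w where "w < n" "f w = l" "a = vs ! w" by (auto simp: cls_def)
    thus False using that free[of w] nth_inj vn by auto
  qed
  have nD: "cls f l \<noteq> D" if "l \<in> {1..j}" for l using notin[OF u(3) that] u(1) by blast
  have fin: "finite \<D>" "card \<D> = i" using \<D> by (auto simp: grouped_dominating_set_def)
  have "j = card (cls f ` {1..j})" using inj_cls[OF V] by (simp add: card_image)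
  also have "\<dots> \<le> card (\<D> - {D})"
  proof (rule card_mono)
    show "cls f ` {1..j} \<subseteq> \<D> - {D}" using full nD by blast
  qed (use fin in simp)
  also have "\<dots> < card \<D>" using u fin by (meson card_Diff1_less)
  finally show "j < k" using i fin by simp
  \<comment> \<open>Generalised over the solution, since it is applied either to the given one or to
    the one obtained by exchanging a leaf.\<close>
  have main: "\<exists>w \<in> set (choices v f (Suc j)). good (child f (Suc j) r w)"
    if "i \<le> k" "grouped_dominating_set r i G \<D>" "\<forall>l \<in> {1..j}. cls f l \<in> \<D>"
      "D \<in> \<D>" "u \<in> D" "(u, ?y) \<in> parcs G \<or> (u = ?y \<and> card (nbrs ?y) \<noteq> 1)" for i \<D> D u
  proof -
    have "u \<in> pverts G" using that(6) nth_vert[OF vn] in_arcsD1 by blast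
    then obtain w where w: "w < n" "vs ! w = u" using vert_index by blast
    have wv: "(w = v \<and> card (nbrs ?y) \<noteq> 1) \<or> adj w v" using that(6) w(2) nth_inj[OF w(1) vn] by auto
    have fw: "f w = 0" using free[OF w(1)] wv by blast
    have "w \<in> set (choices v f (Suc j))"
      using choices_start_iff[OF v lt] w(1) wv arc_sym by blast
    moreover have "good (child f (Suc j) r w)"
      unfolding good_def child_def prod.case
    proof (intro exI[of _ i] exI[of _ \<D>] conjI ballI)
      fix l assume l: "l \<in> {1..Suc j}"
      show "\<exists>D \<in> \<D>. cls (f(w := Suc j)) l \<subseteq> D"
      proof (cases "l = Suc j")
        case True
        have "cls f (Suc j) = {}" using lt by (auto simp: cls_def)
        thus ?thesis using True that(4,5) w by (auto simp: cls_upd_same)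
      next
        case False
        hence "l \<in> {1..j}" using l by auto
        thus ?thesis using cls_upd_other[of f w "Suc j" l] fw that(3) False by auto
      qed
    qed (use that in auto)
    ultimately show ?thesis by blast
  qed
  show "\<exists>w \<in> set (choices v f (Suc j)). good (child f (Suc j) r w)"
  proof (cases "(u, ?y) \<in> parcs G \<or> card (nbrs ?y) \<noteq> 1")
    case True
    thus ?thesis using main[OF i \<D> _ u(2,1)] full u(3) by blast
  next
    \<comment> \<open>The dominator found is \<open>v\<close> itself and \<open>v\<close> is a leaf,
      so \<open>choices\<close> omits it. The exchange touches only \<open>D\<close> and therefore
      keeps all completed units.\<close>
    case False
    then obtain u' where u': "nbrs ?y = {u'}" "?y \<in> D" using u card_1_singletonE by metis
    obtain i' \<D>' D' where *: "i' \<le> i" "grouped_dominating_set r i' G \<D>'" "D' \<in> \<D>'" "u' \<in> D'"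
        "\<D> - {D} \<subseteq> \<D>'"
      using exchange_leaf[OF \<D> u(2) u'(2,1)] by blast
    moreover have "(u', ?y) \<in> parcs G" using u'(1) arc_sym by blast
    moreover have "\<forall>l \<in> {1..j}. cls f l \<in> \<D>'" using full nD *(5) by blast
    ultimately show ?thesis using main[of i' \<D>' D' u'] i by simp
  qed
qed

section \<open>Acceptance and the size of the search tree\<close>

lemma accept_sound:
  assumes V: "valid (f, j, 0)" and v: "\<nexists>v. undominated f v"
  shows "r_grouped_dominating_set_problem G r k"
proof -
  let ?\<D> = "cls f ` {1..j}"
  have gr: "grown (cls f i)" "card (cls f i) = r" if "i \<in> {1..j}" for i
    using V that by (auto simp: valid_def)
  have "dominating_set G (\<Union>?\<D>)" unfolding dominating_set_def
  proof (intro conjI ballI)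
    show "\<Union>?\<D> \<subseteq> pverts G" using cls_subset by blast
    fix x assume x: "x \<in> pverts G - \<Union>?\<D>"
    obtain w where w: "w < n" "vs ! w = x" using x vert_index by blast
    have in_cls: "vs ! a \<in> \<Union>?\<D>" if "a < n" "f a \<noteq> 0" for a
    proof -
      have "f a \<in> {1..j}" using V that by (auto simp: valid_def)
      thus ?thesis using in_cls_iff that(1) by blast
    qed
    have "f w = 0" using in_cls w x by blast
    then obtain a where "a < n" "f a \<noteq> 0" "adj a w" using v w by (auto simp: undominated_def)
    thus "\<exists>u \<in> \<Union>?\<D>. (u, x) \<in> parcs G" using in_cls w by blast
  qed
  moreover have "disjoint ?\<D>"
  proof (unfold disjoint_def, intro ballI impI)
    fix A B assume "A \<in> ?\<D>" "B \<in> ?\<D>" "A \<noteq> B"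
    then obtain a b where "A = cls f a" "B = cls f b" "a \<noteq> b" by blast
    thus "A \<inter> B = {}" using cls_disjoint by simp
  qed
  moreover have "card ?\<D> = j" using inj_cls[OF V] by (simp add: card_image)
  ultimately have "grouped_dominating_set r j G ?\<D>"
    unfolding grouped_dominating_set_def
    using gr(2) grown_connected[OF gr(1)] by (intro conjI ballI) (auto dest: subsetD[OF cls_subset])
  moreover have "j \<le> k" using V by (simp add: valid_def)
  ultimately show ?thesis unfolding r_grouped_dominating_set_problem_def by blast
qed

lemma valid_initial: "valid (\<lambda>_. 0, 0, 0)"
  by (simp add: valid_def used_def)

lemma good_initial: "r_grouped_dominating_set_problem G r k \<Longrightarrow> good (\<lambda>_. 0, 0, 0)"
  by (auto simp: good_def r_grouped_dominating_set_problem_def)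

text \<open>An upper bound for the size of the search tree below a state.\<close>

definition potential :: "(nat \<Rightarrow> nat) \<times> nat \<times> nat \<Rightarrow> nat" where
  "potential = (\<lambda>(f, j, s). \<Sum>i \<le> min n (k * r) - used f. (\<Delta> ^ (2 * r)) ^ i)"

text \<open>A geometric sum: if \<open>p\<close> is the sum with one step fewer left, the parent has
  potential \<open>1 + F * p\<close>, where \<open>F\<close> is the branching bound. The summand 1
  pays for the parent itself.\<close>

lemma potential_children:
  assumes "length ws \<le> \<Delta> ^ (2 * r)" "\<And>w. w \<in> set ws \<Longrightarrow> w < n \<and> f w = 0 \<and> valid (child f (Suc j) s w)"
  shows "(\<Sum>w \<leftarrow> ws. potential (child f (Suc j) s w)) < potential (f, j', s')"
proof -
  let ?R = "min n (k * r)" let ?F = "\<Delta> ^ (2 * r)"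
  define p where "p = (\<Sum>i < ?R - used f. ?F ^ i)"
  have "potential (child f (Suc j) s w) = p" if "w \<in> set ws" for w
  proof -
    have "used (f(w := Suc j)) = Suc (used f)" using used_upd assms(2)[OF that] by simp
    moreover have "used (f(w := Suc j)) \<le> ?R"
      using valid_used_le assms(2)[OF that] unfolding child_def by blast
    \<comment> \<open>The child still respects the cap, so \<open>used f < ?R\<close> and the
      truncated subtraction really drops by one.\<close>
    ultimately have "{..?R - used (f(w := Suc j))} = {..<?R - used f}" by auto
    thus ?thesis by (simp add: potential_def child_def p_def)
  qed
  hence "(\<Sum>w \<leftarrow> ws. potential (child f (Suc j) s w)) = length ws * p"
    by (simp add: sum_list_triv cong: map_cong)
  also have "\<dots> \<le> ?F * p" using assms(1) by (rule mult_le_mono1)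
  also have "\<dots> < 1 + ?F * p" by simp
  also have "\<dots> = potential (f, j', s')"
    unfolding potential_def p_def prod.case
    by (simp add: sum.atMost_shift sum_distrib_left)
  finally show ?thesis .
qed

text \<open>Each of the at most \<open>n + 1\<close> levels has at most
  \<open>(\<Delta> ^ (2 * r)) ^ (k * r)\<close> states, which is where the exponent
  \<open>2 * k * r^2\<close> originates.\<close>

lemma potential_initial: "potential (\<lambda>_. 0, 0, 0) \<le> (n + 1) * \<Delta> ^ (2 * (k * r\<^sup>2))"
proof -
  have "potential (\<lambda>_. 0, 0, 0) \<le> (\<Sum>i \<le> min n (k * r). (\<Delta> ^ (2 * r)) ^ (k * r))"
    unfolding potential_def prod.case
  proof (rule sum_le_included[where i = id])
    show "\<forall>x \<in> {..min n (k * r) - used (\<lambda>_. 0)}. \<exists>y \<in> {..min n (k * r)}. id y = x \<and>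
        (\<Delta> ^ (2 * r)) ^ x \<le> (\<Delta> ^ (2 * r)) ^ (k * r)"
      by (auto simp: used_def intro!: power_increasing)
  qed simp_all
  also have "\<dots> = (min n (k * r) + 1) * \<Delta> ^ (2 * (k * r\<^sup>2))"
    by (simp add: power_mult[symmetric] power2_eq_square mult_ac)
  also have "\<dots> \<le> (n + 1) * \<Delta> ^ (2 * (k * r\<^sup>2))" by (intro mult_le_mono1) simp
  finally show ?thesis .
qed

end

section \<open>Time-bounded runs\<close>

text \<open>A weakest precondition with a time budget: the rules below execute straight-line code
  symbolically and subtract its cost from \<open>T\<close>.\<close>

definition runs :: "nat list \<Rightarrow> prog \<Rightarrow> memory \<Rightarrow> nat \<Rightarrow> (memory \<Rightarrow> bool) \<Rightarrow> bool" where
  "runs x c m T Q \<longleftrightarrow> (\<exists>t m'. exec x c m t m' \<and> t \<le> T \<and> Q m')"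

lemma runs_skip [simp]: "runs x Skip m T Q \<longleftrightarrow> 1 \<le> T \<and> Q m"
proof -
  have "exec x Skip m t m' \<longleftrightarrow> t = 1 \<and> m' = m" for t m'
    by (auto elim: exec_SkipE intro: exec.Skip[of x m, simplified])
  thus ?thesis by (simp add: runs_def)
qed

lemma runs_assign [simp]: "runs x (Assign a e) m T Q \<longleftrightarrow>
    1 + eval_cost a + eval_cost e \<le> T \<and> Q (m(eval x m a := eval x m e))"
  unfolding runs_def by (auto elim!: exec_AssignE) (use exec.Assign in fastforce)

lemma runs_seq: "runs x (Seq c c') m T Q \<longleftrightarrow>
    (\<exists>t. t \<le> T \<and> runs x c m t (\<lambda>m'. runs x c' m' (T - t) Q))"
proof
  assume "runs x (Seq c c') m T Q"
  then obtain t m' where tm: "exec x (Seq c c') m t m'" "t \<le> T" "Q m'" unfolding runs_def by blast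
  from tm(1) obtain t1 t2 m1 where "t = t1 + t2" "exec x c m t1 m1" "exec x c' m1 t2 m'"
    by (rule exec_SeqE) blast
  thus "\<exists>t. t \<le> T \<and> runs x c m t (\<lambda>m'. runs x c' m' (T - t) Q)"
    using tm(2,3) unfolding runs_def by (intro exI[of _ t1]) fastforce
next
  assume "\<exists>t. t \<le> T \<and> runs x c m t (\<lambda>m'. runs x c' m' (T - t) Q)"
  then obtain t t1 t2 m' m'' where "t \<le> T" "exec x c m t1 m'" "t1 \<le> t" "exec x c' m' t2 m''"
    "t2 \<le> T - t" "Q m''" unfolding runs_def by blast
  thus "runs x (Seq c c') m T Q" unfolding runs_def
    by (intro exI[of _ "t1 + t2"] exI[of _ m'']) (auto intro: exec.Seq)
qed

lemma runs_mono: "runs x c m T Q \<Longrightarrow> T \<le> T' \<Longrightarrow> (\<And>m'. Q m' \<Longrightarrow> Q' m') \<Longrightarrow> runs x c m T' Q'"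
  unfolding runs_def by (meson le_trans)

lemma runs_seqI:
  assumes "runs x c m t R" "t + t' \<le> T" "\<And>m'. R m' \<Longrightarrow> runs x c' m' t' Q"
  shows "runs x (Seq c c') m T Q"
  unfolding runs_seq
proof (intro exI[of _ t] conjI)
  show "runs x c m t (\<lambda>m'. runs x c' m' (T - t) Q)"
    using assms(2) by (auto intro!: runs_mono[OF assms(1)] runs_mono[OF assms(3)])
qed (use assms in auto)

lemma runs_seq_assoc [simp]: "runs x (Seq (Seq a b) c) m T Q \<longleftrightarrow> runs x (Seq a (Seq b c)) m T Q"
proof -
  have "(\<exists>t. exec x (Seq (Seq a b) c) m t m' \<and> t \<le> T) \<longleftrightarrow>
      (\<exists>t. exec x (Seq a (Seq b c)) m t m' \<and> t \<le> T)" for m'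
    by (auto elim!: exec_SeqE intro: exec.Seq simp: add.assoc)
      (metis exec.Seq add.assoc)+
  thus ?thesis unfolding runs_def by metis
qed

lemma runs_seq_skip [simp]: "runs x (Seq Skip c) m T Q \<longleftrightarrow> 1 \<le> T \<and> runs x c m (T - 1) Q"
  unfolding runs_seq by (auto elim: runs_mono)

lemma runs_seq_assign [simp]: "runs x (Seq (Assign a e) c) m T Q \<longleftrightarrow>
    1 + eval_cost a + eval_cost e \<le> T \<and>
    runs x c (m(eval x m a := eval x m e)) (T - (1 + eval_cost a + eval_cost e)) Q"
  unfolding runs_seq runs_assign by (auto elim: runs_mono)

lemma runs_cond [simp]: "runs x (Cond e c c') m T Q \<longleftrightarrow> 1 + eval_cost e \<le> T \<and>
    (if eval x m e \<noteq> 0 then runs x c m (T - (1 + eval_cost e)) Q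
     else runs x c' m (T - (1 + eval_cost e)) Q)"
proof -
  have *: "exec x (Cond e c c') m t m' \<longleftrightarrow> (\<exists>t'. t = 1 + eval_cost e + t' \<and>
      exec x (if eval x m e \<noteq> 0 then c else c') m t' m')" for t m'
    by (cases "eval x m e = 0") (auto elim!: exec_CondE intro: exec.CondF[simplified] exec.CondT[simplified])
  have "runs x (Cond e c c') m T Q \<longleftrightarrow> (\<exists>t m'. exec x (if eval x m e \<noteq> 0 then c else c') m t m' \<and>
      1 + eval_cost e + t \<le> T \<and> Q m')"
    unfolding runs_def * by metis
  moreover have "1 + eval_cost e + t \<le> T \<longleftrightarrow> 1 + eval_cost e \<le> T \<and> t \<le> T - (1 + eval_cost e)" for t
    by auto
  ultimately show ?thesis unfolding runs_def by (cases "eval x m e = 0") auto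
qed

lemma runs_seq_cond [simp]: "runs x (Seq (Cond e c c') d) m T Q \<longleftrightarrow> 1 + eval_cost e \<le> T \<and>
    (if eval x m e \<noteq> 0 then runs x (Seq c d) m (T - (1 + eval_cost e)) Q
     else runs x (Seq c' d) m (T - (1 + eval_cost e)) Q)"
proof -
  have shift: "(\<exists>t \<le> T. a \<le> t \<and> F (t - a) (T - t)) \<longleftrightarrow> a \<le> T \<and> (\<exists>t \<le> T - a. F t (T - a - t))"
    for a :: nat and F
  proof
    assume "\<exists>t \<le> T. a \<le> t \<and> F (t - a) (T - t)"
    then obtain t where "t \<le> T" "a \<le> t" "F (t - a) (T - t)" by blast
    thus "a \<le> T \<and> (\<exists>t \<le> T - a. F t (T - a - t))" by (intro conjI exI[of _ "t - a"]) auto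
  next
    assume "a \<le> T \<and> (\<exists>t \<le> T - a. F t (T - a - t))"
    then obtain t where "a \<le> T" "t \<le> T - a" "F t (T - a - t)" by blast
    thus "\<exists>t \<le> T. a \<le> t \<and> F (t - a) (T - t)" by (intro exI[of _ "t + a"]) (auto simp: add.commute)
  qed
  show ?thesis
    unfolding runs_seq runs_cond
    using shift[of "1 + eval_cost e" "\<lambda>t t'. runs x c m t (\<lambda>m'. runs x d m' t' Q)"]
      shift[of "1 + eval_cost e" "\<lambda>t t'. runs x c' m t (\<lambda>m'. runs x d m' t' Q)"]
    by (cases "eval x m e = 0") simp_all
qed

text \<open>The variant \<open>p\<close> bounds the remaining iterations and may drop by more than
  one, which suits the potential. One last test is paid on exit.\<close>

lemma runs_while:
  assumes "I p m"
    and "\<And>p m. I p m \<Longrightarrow> eval x m g \<noteq> 0 \<Longrightarrow> runs x c m T (\<lambda>m'. \<exists>q < p. I q m')"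
    and "\<And>p m. I p m \<Longrightarrow> eval x m g = 0 \<Longrightarrow> Q m"
    and "p * (T + 1 + eval_cost g) + 1 + eval_cost g \<le> T'"
  shows "runs x (While g c) m T' Q"
proof -
  have "runs x (While g c) m (p * (T + 1 + eval_cost g) + 1 + eval_cost g) Q"
    using assms(1)
  proof (induction p arbitrary: m rule: less_induct)
    case (less p)
    show ?case
    proof (cases "eval x m g = 0")
      case True
      thus ?thesis using assms(3)[OF less.prems True] exec.WhileF[OF True]
        unfolding runs_def by fastforce
    next
      case False
      from assms(2)[OF less.prems False] obtain t m1 q
        where 1: "exec x c m t m1" "t \<le> T" "q < p" "I q m1" unfolding runs_def by blast
      from less.IH[OF this(3,4)] obtain t' m'
        where 2: "exec x (While g c) m1 t' m'" "t' \<le> q * (T + 1 + eval_cost g) + 1 + eval_cost g" "Q m'"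
        unfolding runs_def by blast
      have "Suc q * (T + 1 + eval_cost g) \<le> p * (T + 1 + eval_cost g)"
        using 1(3) by (intro mult_le_mono1) simp
      hence "1 + eval_cost g + t + t' \<le> p * (T + 1 + eval_cost g) + 1 + eval_cost g"
        using 1 2 by simp
      thus ?thesis using exec.WhileT[OF False 1(1) 2(1)] 2(3) unfolding runs_def by blast
    qed
  qed
  thus ?thesis using assms(4) by (rule runs_mono)
qed

text \<open>The invariant counts completed iterations; the variant is \<open>b - i\<close>.\<close>

lemma runs_for:
  assumes "I 0 m"
    and "\<And>i m. i < b \<Longrightarrow> I i m \<Longrightarrow> eval x m g \<noteq> 0 \<and> runs x c m T (I (Suc i))"
    and "\<And>m. I b m \<Longrightarrow> eval x m g = 0 \<and> Q m"
    and "b * (T + 1 + eval_cost g) + 1 + eval_cost g \<le> T'"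
  shows "runs x (While g c) m T' Q"
proof (rule runs_while[where I = "\<lambda>p m. p \<le> b \<and> I (b - p) m"])
  show "b \<le> b \<and> I (b - b) m" using assms(1) by simp
next
  fix p m assume *: "p \<le> b \<and> I (b - p) m" "eval x m g \<noteq> 0"
  have "p \<noteq> 0" using * assms(3) by (metis diff_zero)
  hence "runs x c m T (I (Suc (b - p)))" using assms(2)[of "b - p" m] * by auto
  thus "runs x c m T (\<lambda>m'. \<exists>q<p. q \<le> b \<and> I (b - q) m')"
  proof (rule runs_mono[OF _ order_refl])
    fix m' assume "I (Suc (b - p)) m'"
    thus "\<exists>q<p. q \<le> b \<and> I (b - q) m'" using \<open>p \<noteq> 0\<close> *
      by (intro exI[of _ "p - 1"]) (auto simp: Suc_diff_le)
  qed
next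
  fix p m assume *: "p \<le> b \<and> I (b - p) m" "eval x m g = 0"
  hence "p = 0" using assms(2)[of "b - p" m] by (cases p) auto
  thus "Q m" using * assms(3) by simp
qed (rule assms(4))

definition inp :: "nat list \<Rightarrow> nat \<Rightarrow> nat" where
  "inp x i = (if i < length x then x ! i else 0)"

lemma eval_Inp [simp]: "eval x m (Inp e) = inp x (eval x m e)"
  by (simp add: inp_def)

declare eval.simps(2) [simp del]

abbreviation loc :: "nat \<Rightarrow> exp" where "loc a \<equiv> Mem (Const a)"
abbreviation set_loc :: "nat \<Rightarrow> exp \<Rightarrow> prog" where "set_loc a e \<equiv> Assign (Const a) e"

text \<open>Two opposite truncated differences add up to the absolute difference.\<close>

definition eq_exp :: "exp \<Rightarrow> exp \<Rightarrow> exp" where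
  "eq_exp e e' = Sub (Const 1) (Add (Sub e e') (Sub e' e))"

lemma eval_eq_exp [simp]: "eval x m (eq_exp e e') \<noteq> 0 \<longleftrightarrow> eval x m e = eval x m e'"
  by (auto simp: eq_exp_def)

lemma cost_eq_exp [simp]: "eval_cost (eq_exp e e') = 5 + 2 * eval_cost e + 2 * eval_cost e'"
  by (simp add: eq_exp_def)

section \<open>The program\<close>

text \<open>
  Fixed addresses: the answer, the input parameters \<open>n\<close>, \<open>r\<close>, \<open>k\<close>, head and tail of the queue, loop
  counters and scratch cells, and the components \<open>v\<close>, \<open>j\<close>, \<open>s\<close> of the state at the head. From
  address \<open>20\<close> on lies a queue of search states, each a frame of \<open>n + 2\<close> cells. Cells behind the
  head are never reused.
\<close>

abbreviation (input) ANS :: nat where "ANS \<equiv> 0"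
abbreviation (input) N :: nat where "N \<equiv> 2"
abbreviation (input) R :: nat where "R \<equiv> 3"
abbreviation (input) K :: nat where "K \<equiv> 4"
abbreviation (input) H :: nat where "H \<equiv> 5"
abbreviation (input) T :: nat where "T \<equiv> 6"
abbreviation (input) W :: nat where "W \<equiv> 7"
abbreviation (input) X :: nat where "X \<equiv> 8"
abbreviation (input) P :: nat where "P \<equiv> 9"
abbreviation (input) C :: nat where "C \<equiv> 10"
abbreviation (input) V :: nat where "V \<equiv> 11"
abbreviation (input) J :: nat where "J \<equiv> 12"
abbreviation (input) S :: nat where "S \<equiv> 13"
abbreviation (input) I :: nat where "I \<equiv> 14"
abbreviation (input) OT :: nat where "OT \<equiv> 15"

text \<open>Sets \<open>C\<close> iff some \<open>X\<close> satisfying \<open>e\<close> is adjacent to \<open>W\<close>; \<open>P\<close> walks down column \<open>W\<close> of the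
  adjacency matrix, as there is no multiplication.\<close>

definition scan :: "exp \<Rightarrow> prog" where
  "scan e = Seq (set_loc C (Const 0)) (Seq (set_loc X (Const 0))
     (Seq (set_loc P (Add (Const 3) (loc W)))
     (While (Sub (loc N) (loc X))
       (Seq (Cond (Inp (loc P)) (Cond e (set_loc C (Const 1)) Skip) Skip)
       (Seq (set_loc X (Add (loc X) (Const 1))) (set_loc P (Add (loc P) (loc N))))))))"

text \<open>The test must be correct in every memory that differs only in the scratch cells, because
  it is evaluated inside the loop. The longest test used costs 35.\<close>

lemma runs_scan:
  assumes n: "m N = n"
    and e: "\<And>m'. (\<And>a. a \<notin> {X, P, C} \<Longrightarrow> m' a = m a) \<Longrightarrow> m' X < n \<Longrightarrow> eval x m' e \<noteq> 0 \<longleftrightarrow> cond (m' X)"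
    and c: "eval_cost e \<le> 40"
  shows "runs x (scan e) m (100 * (n + 1)) (\<lambda>m'. (\<forall>a. a \<notin> {X, P, C} \<longrightarrow> m' a = m a) \<and>
    (m' C \<noteq> 0 \<longleftrightarrow> (\<exists>y < n. cond y \<and> inp x (3 + y * n + m W) \<noteq> 0)))" (is "runs _ _ _ _ ?Q")
proof -
  define Inv where "Inv i m' \<longleftrightarrow> (\<forall>a. a \<notin> {X, P, C} \<longrightarrow> m' a = m a) \<and> m' X = i \<and>
    m' P = 3 + i * n + m W \<and> (m' C \<noteq> 0 \<longleftrightarrow> (\<exists>y < i. cond y \<and> inp x (3 + y * n + m W) \<noteq> 0))" for i m'
  let ?body = "Seq (Cond (Inp (loc P)) (Cond e (set_loc C (Const 1)) Skip) Skip)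
       (Seq (set_loc X (Add (loc X) (Const 1))) (set_loc P (Add (loc P) (loc N))))"
  have loop: "runs x (While (Sub (loc N) (loc X)) ?body) m0 (n * 80 + 10) ?Q" if "Inv 0 m0" for m0
  proof (rule runs_for[where I = Inv and b = n and T = 70])
    show "Inv 0 m0" by fact
  next
    fix i m' assume i: "i < n" "Inv i m'"
    have ee: "eval x m' e \<noteq> 0 \<longleftrightarrow> cond i" using e[of m'] i by (auto simp: Inv_def)
    have ip: "m' P = 3 + i * n + m W" "m' N = n" "m' X = i" using i n by (auto simp: Inv_def)
    have "runs x ?body m' 70 (Inv (Suc i))"
      using c ee ip i by (auto simp: Inv_def less_Suc_eq n)
    thus "eval x m' (Sub (loc N) (loc X)) \<noteq> 0 \<and> runs x ?body m' 70 (Inv (Suc i))"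
      using i ip by simp
  next
    fix m' assume "Inv n m'"
    thus "eval x m' (Sub (loc N) (loc X)) = 0 \<and> ?Q m'" using n by (auto simp: Inv_def)
  qed simp
  show ?thesis unfolding scan_def runs_seq_assign
    by (intro conjI runs_mono[OF loop]) (auto simp: Inv_def)
qed

text \<open>The labels are copied before the chosen one is overwritten. The parameter is the address
  of a cell holding the vertex, so \<open>W\<close> and \<open>V\<close> can both serve.\<close>

definition push :: "nat \<Rightarrow> prog" where
  "push a = Seq (set_loc I (Const 0))
     (Seq (While (Sub (loc N) (loc I))
       (Seq (Assign (Add (loc T) (loc I)) (Mem (Add (loc H) (loc I)))) (set_loc I (Add (loc I) (Const 1)))))
     (Seq (Assign (Add (loc T) (loc a)) (loc J))
     (Seq (Assign (Add (loc T) (loc N)) (loc J))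
     (Seq (Assign (Add (loc T) (Add (loc N) (Const 1))) (Sub (loc S) (Const 1)))
       (set_loc T (Add (loc T) (Add (loc N) (Const 2))))))))"

text \<open>The bound \<open>m H + n \<le> m T\<close> keeps source and target of the copy
  apart.\<close>

lemma runs_push:
  assumes n: "m N = n" and h: "20 \<le> m H" "m H + n \<le> m T"
    and a: "a < 20" "a \<noteq> I" "m a < n"
  shows "runs x (push a) m (100 * (n + 1)) (\<lambda>m'.
    (\<forall>b. b \<notin> {I, T} \<and> \<not> (m T \<le> b \<and> b < m T + n + 2) \<longrightarrow> m' b = m b) \<and> m' T = m T + n + 2 \<and>
    (\<forall>w < n. m' (m T + w) = (if w = m a then m J else m (m H + w))) \<and>
    m' (m T + n) = m J \<and> m' (m T + n + 1) = m S - 1)" (is "runs _ _ _ _ ?Q")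
proof -
  define Inv where "Inv i m' \<longleftrightarrow> (\<forall>b. b \<noteq> I \<and> \<not> (m T \<le> b \<and> b < m T + i) \<longrightarrow> m' b = m b) \<and> m' I = i \<and>
    (\<forall>w < i. m' (m T + w) = m (m H + w))" for i m'
  let ?body = "Seq (Assign (Add (loc T) (loc I)) (Mem (Add (loc H) (loc I)))) (set_loc I (Add (loc I) (Const 1)))"
  have loop: "runs x (While (Sub (loc N) (loc I)) ?body) m0 (n * 25 + 10) (Inv n)" if "Inv 0 m0" for m0
  proof (rule runs_for[where I = Inv and b = n and T = 18])
    show "Inv 0 m0" by fact
  next
    fix i m' assume i: "i < n" "Inv i m'"
    have ip: "m' N = n" "m' I = i" "m' T = m T" "m' H = m H" "m' (m H + i) = m (m H + i)"
      using i n h by (auto simp: Inv_def)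
    have "Inv (Suc i) (m'(m T + i := m (m H + i), I := Suc i))"
      using i h unfolding Inv_def by (auto simp: less_Suc_eq)
    thus "eval x m' (Sub (loc N) (loc I)) \<noteq> 0 \<and> runs x ?body m' 18 (Inv (Suc i))"
      using i ip h by simp
  next
    fix m' assume "Inv n m'"
    thus "eval x m' (Sub (loc N) (loc I)) = 0 \<and> Inv n m'" using n h by (auto simp: Inv_def)
  qed simp
  show ?thesis unfolding push_def runs_seq_assign
  proof (intro conjI runs_seqI[OF loop, where t' = 50])
    fix m' assume I: "Inv n m'"
    have ip: "m' N = n" "m' T = m T" "m' a = m a" "m' J = m J" "m' S = m S"
      using I h n a by (auto simp: Inv_def)
    let ?M = "m'(m T + m a := m J, m T + n := m J, m T + n + 1 := m S - 1, T := m T + n + 2)"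
    have QM: "?Q ?M"
    proof (intro conjI allI impI)
      fix b assume b: "b \<notin> {I, T} \<and> \<not> (m T \<le> b \<and> b < m T + n + 2)"
      hence "b \<noteq> m T + m a" "b \<noteq> m T + n" "b \<noteq> m T + n + 1" "b \<noteq> T" using a by auto
      moreover have "m' b = m b" using I b unfolding Inv_def by auto
      ultimately show "?M b = m b" by simp
    next
      fix w assume "w < n"
      thus "?M (m T + w) = (if w = m a then m J else m (m H + w))"
        using I h unfolding Inv_def by auto
    qed (use h in simp_all)
    have runs_M: "runs x (Seq (Assign (Add (loc T) (loc a)) (loc J))
     (Seq (Assign (Add (loc T) (loc N)) (loc J))
     (Seq (Assign (Add (loc T) (Add (loc N) (Const 1))) (Sub (loc S) (Const 1)))
       (set_loc T (Add (loc T) (Add (loc N) (Const 2))))))) m' 50 Q" if "Q ?M" for Q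
      using that h ip by simp
    show "runs x (Seq (Assign (Add (loc T) (loc a)) (loc J))
     (Seq (Assign (Add (loc T) (loc N)) (loc J))
     (Seq (Assign (Add (loc T) (Add (loc N) (Const 1))) (Sub (loc S) (Const 1)))
       (set_loc T (Add (loc T) (Add (loc N) (Const 2))))))) m' 50 ?Q"
      by (rule runs_M) (rule QM)
  qed (use h in \<open>auto simp: Inv_def\<close>)
qed

section \<open>The queue in memory as a list of states\<close>

definition frame :: "memory \<Rightarrow> nat \<Rightarrow> nat \<Rightarrow> (nat \<Rightarrow> nat) \<times> nat \<times> nat \<Rightarrow> bool" where
  "frame m n p = (\<lambda>(f, j, s). (\<forall>w < n. m (p + w) = f w) \<and> m (p + n) = j \<and> m (p + n + 1) = s)"

primrec queue :: "memory \<Rightarrow> nat \<Rightarrow> nat \<Rightarrow> ((nat \<Rightarrow> nat) \<times> nat \<times> nat) list \<Rightarrow> nat \<Rightarrow> bool" where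
  "queue m n p [] q \<longleftrightarrow> q = p"
| "queue m n p (\<sigma> # \<sigma>s) q \<longleftrightarrow> frame m n p \<sigma> \<and> queue m n (p + n + 2) \<sigma>s q"

text \<open>Turns pointer comparisons into counts of states, both for emptiness of the queue and for
  detecting a single candidate.\<close>

lemma queue_length: "queue m n p \<sigma>s q \<Longrightarrow> q = p + length \<sigma>s * (n + 2)"
proof (induction \<sigma>s arbitrary: p)
  case (Cons \<sigma> \<sigma>s)
  thus ?case using Cons.IH[of "p + n + 2"] by simp
qed simp

lemma queue_append: "queue m n p (\<sigma>s @ \<tau>s) q \<longleftrightarrow> (\<exists>u. queue m n p \<sigma>s u \<and> queue m n u \<tau>s q)"
  by (induction \<sigma>s arbitrary: p) auto

lemma frame_cong: "(\<And>b. p \<le> b \<Longrightarrow> b < p + n + 2 \<Longrightarrow> m' b = m b) \<Longrightarrow> frame m' n p \<sigma> \<longleftrightarrow> frame m n p \<sigma>"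
  by (cases \<sigma>) (simp add: frame_def)

lemma queue_cong:
  "queue m n p \<sigma>s q \<Longrightarrow> (\<And>b. p \<le> b \<Longrightarrow> b < q \<Longrightarrow> m' b = m b) \<Longrightarrow> queue m' n p \<sigma>s q"
proof (induction \<sigma>s arbitrary: p)
  case (Cons \<sigma> \<sigma>s)
  have "p + n + 2 \<le> q" using Cons.prems(1) queue_length by fastforce
  moreover from this have "frame m' n p \<sigma> = frame m n p \<sigma>"
    using Cons.prems(2) by (intro frame_cong) auto
  ultimately show ?case using Cons by auto
qed simp

text \<open>\<open>V\<close> enters with the value \<open>n\<close>, which stands for none. Later
  hits overwrite earlier ones, as any undominated vertex serves.\<close>

definition find_undominated :: prog where
  "find_undominated = Seq (set_loc W (Const 0)) (While (Sub (loc N) (loc W))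
     (Seq (scan (Mem (Add (loc H) (loc X))))
     (Seq (Cond (Add (loc C) (Mem (Add (loc H) (loc W)))) Skip (set_loc V (loc W)))
       (set_loc W (Add (loc W) (Const 1))))))"

text \<open>\<open>OT\<close> keeps the old tail: an advance by exactly one frame means a single
  candidate, and then \<open>V\<close> is not pushed.\<close>

definition expand :: prog where
  "expand = Seq (set_loc OT (loc T)) (Seq (set_loc W (Const 0))
     (Seq (While (Sub (loc N) (loc W))
       (Seq (scan (Add (eq_exp (loc X) (loc V)) (eq_exp (Mem (Add (loc H) (loc X))) (loc J))))
       (Seq (Cond (loc C) (Cond (Mem (Add (loc H) (loc W))) Skip (push W)) Skip)
         (set_loc W (Add (loc W) (Const 1))))))
     (Cond (Sub (loc N) (loc V))
       (Cond (eq_exp (loc T) (Add (loc OT) (Add (loc N) (Const 2)))) Skip (push V)) Skip)))"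

text \<open>At this point \<open>S = 0\<close> marks a state without children, be it rejected or
  accepted.\<close>

definition process_tail :: prog where
  "process_tail = Seq (Cond (loc S) expand Skip) (set_loc H (Add (loc H) (Add (loc N) (Const 2))))"

text \<open>On acceptance the tail is pulled back to the head. The head then moves past it, and
  truncated subtraction ends the main loop.\<close>

definition process_head :: prog where
  "process_head = Seq (set_loc J (Mem (Add (loc H) (loc N))))
     (Seq (set_loc S (Mem (Add (loc H) (Add (loc N) (Const 1)))))
     (Seq (set_loc V (loc N))
     (Seq (Cond (loc S) Skip (Seq find_undominated
       (Cond (Sub (loc N) (loc V))
         (Cond (Sub (loc K) (loc J)) (Seq (set_loc J (Add (loc J) (Const 1))) (set_loc S (loc R))) Skip)
         (Seq (set_loc ANS (Const 1)) (set_loc T (loc H))))))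
       process_tail)))"

text \<open>\<open>22 + n\<close> is one frame of \<open>n + 2\<close> cells beyond 20: fresh memory
  already holds the initial state.\<close>

definition solver :: prog where
  "solver = Seq (set_loc N (Inp (Const 0))) (Seq (set_loc R (Inp (Const 1)))
     (Seq (set_loc K (Inp (Const 2))) (Seq (set_loc H (Const 20))
     (Seq (set_loc T (Add (Const 22) (loc N)))
       (While (Sub (loc T) (loc H)) process_head)))))"

section \<open>Reading the encoded instance\<close>

lemma nth_concat_rectangular:
  assumes "\<And>u. u \<in> set us \<Longrightarrow> length (g u) = l" "y < length us" "w < l"
  shows "concat (map g us) ! (y * l + w) = g (us ! y) ! w"
  using assms
proof (induction us arbitrary: y)
  case (Cons u us)
  show ?case
  proof (cases y)
    case (Suc y')
    thus ?thesis using Cons.IH[of y'] Cons.prems by (simp add: nth_append)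
  qed (use Cons.prems in \<open>simp add: nth_append\<close>)
qed simp

lemma length_concat_rectangular:
  "(\<And>u. u \<in> set us \<Longrightarrow> length (g u) = l) \<Longrightarrow> length (concat (map g us)) = length us * l"
  by (induction us) auto

lemma length_encode: "length (encode G vs r k) = 3 + length vs * length vs"
  by (simp add: encode_def length_concat_rectangular[of _ _ "length vs"] del: length_concat)

lemma inp_encode:
  "inp (encode G vs r k) 0 = length vs" "inp (encode G vs r k) (Suc 0) = r" "inp (encode G vs r k) 2 = k"
  "y < length vs \<Longrightarrow> w < length vs \<Longrightarrow>
    inp (encode G vs r k) (3 + y * length vs + w) \<noteq> 0 \<longleftrightarrow> (vs ! y, vs ! w) \<in> parcs G"
proof -
  let ?n = "length vs"
  assume yw: "y < ?n" "w < ?n"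
  have "Suc y * ?n \<le> ?n * ?n" using yw(1) by (intro mult_le_mono1) simp
  hence "3 + y * ?n + w < length (encode G vs r k)" using yw(2) length_encode[of G vs r k] by simp
  moreover have "encode G vs r k ! (3 + y * ?n + w) = (if (vs ! y, vs ! w) \<in> parcs G then 1 else 0)"
    using yw nth_concat_rectangular[of vs "\<lambda>u. map (\<lambda>v. if (u, v) \<in> parcs G then 1 else 0) vs" ?n y w]
    by (simp add: encode_def nth_append numeral_3_eq_3)
  ultimately show "inp (encode G vs r k) (3 + y * ?n + w) \<noteq> 0 \<longleftrightarrow> (vs ! y, vs ! w) \<in> parcs G"
    by (simp add: inp_def)
qed (auto simp: inp_def length_encode, auto simp: encode_def)

section \<open>Correctness and running time\<close>

context unit_search
begin

lemma choices_grow_free: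
  assumes "w \<in> set (choices n f j)" shows "w < n \<and> f w = 0 \<and> (\<exists>x < n. f x = j \<and> adj x w)"
  using assms by (auto simp: choices_def cand_def)

lemma children_grow:
  assumes V: "valid (f, j, s)" and s: "s > 0"
  defines "cs \<equiv> map (child f j s) (choices n f j)"
  shows "\<forall>c \<in> set cs. valid c" "(\<Sum>c \<leftarrow> cs. potential c) < potential (f, j, s)"
    "good (f, j, s) \<Longrightarrow> \<exists>c \<in> set cs. good c"
proof -
  \<comment> \<open>\<open>potential_children\<close> writes the new label as a successor because
    label 0 would not count as used.\<close>
  obtain j' where j': "j = Suc j'" using V s by (cases j) (auto simp: valid_def)
  have v: "w < n \<and> f w = 0 \<and> valid (child f j s w)" if "w \<in> set (choices n f j)" for w
    using choices_grow_free[OF that] valid_child_grow[OF V s] by blast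
  show "\<forall>c \<in> set cs. valid c" using v by (auto simp: cs_def)
  show "(\<Sum>c \<leftarrow> cs. potential c) < potential (f, j, s)"
    using potential_children[of "choices n f j" f j' s j s] card_choices_grow[OF V s] v
    by (simp add: cs_def j' comp_def)
  show "\<exists>c \<in> set cs. good c" if "good (f, j, s)" using good_grow[OF V s that] by (auto simp: cs_def)
qed

lemma children_start:
  assumes V: "valid (f, j, 0)" and v: "undominated f v" and jk: "j < k"
  defines "cs \<equiv> map (child f (Suc j) r) (choices v f (Suc j))"
  shows "\<forall>c \<in> set cs. valid c" "(\<Sum>c \<leftarrow> cs. potential c) < potential (f, j, 0)"
    "good (f, j, 0) \<Longrightarrow> \<exists>c \<in> set cs. good c"
proof -
  have lt: "\<forall>w < n. f w < Suc j" using V by (auto simp: valid_def)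
  have ok: "w < n \<and> f w = 0 \<and> valid (child f (Suc j) r w)" if "w \<in> set (choices v f (Suc j))" for w
  proof -
    have w: "w < n" "adj v w \<or> w = v" using choices_start_iff[OF v lt] that by blast+
    hence "f w = 0" using v arc_sym by (auto simp: undominated_def)
    thus ?thesis using w valid_child_start[OF V jk] by blast
  qed
  show "\<forall>c \<in> set cs. valid c" using ok by (auto simp: cs_def)
  show "(\<Sum>c \<leftarrow> cs. potential c) < potential (f, j, 0)"
    using potential_children[of "choices v f (Suc j)" f j r j 0] card_choices_start[OF v lt] ok
    by (simp add: cs_def comp_def)
  show "\<exists>c \<in> set cs. good c" if "good (f, j, 0)" using good_start[OF V v that] by (auto simp: cs_def)
qed

abbreviation "inst \<equiv> encode G vs r k"

section \<open>Runs of the parts of the program\<close>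

lemma runs_find_undominated:
  assumes n: "m N = n" and f: "\<And>w. w < n \<Longrightarrow> m (m H + w) = f w" and h: "20 \<le> m H" and v: "m V = n"
  shows "runs inst find_undominated m (200 * (n + 1)\<^sup>2) (\<lambda>m'. (\<forall>a. a \<notin> {W, X, P, C, V} \<longrightarrow> m' a = m a) \<and>
    (undominated f (m' V) \<or> m' V = n \<and> (\<nexists>v. undominated f v)))" (is "runs _ _ _ _ ?Q")
proof -
  define Inv where "Inv i m' \<longleftrightarrow> (\<forall>a. a \<notin> {W, X, P, C, V} \<longrightarrow> m' a = m a) \<and> m' W = i \<and>
    (undominated f (m' V) \<or> m' V = n \<and> (\<forall>v < i. \<not> undominated f v))" for i m'
  let ?body = "Seq (scan (Mem (Add (loc H) (loc X))))
     (Seq (Cond (Add (loc C) (Mem (Add (loc H) (loc W)))) Skip (set_loc V (loc W)))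
       (set_loc W (Add (loc W) (Const 1))))"
  have loop: "runs inst (While (Sub (loc N) (loc W)) ?body) m0 (n * (100 * (n + 1) + 56) + 10) ?Q"
    if "Inv 0 m0" for m0
  proof (rule runs_for[where I = Inv and b = n and T = "100 * (n + 1) + 50"])
    show "Inv 0 m0" by fact
  next
    fix i m' assume i: "i < n" "Inv i m'"
    have same: "m' a = m a" if "a \<notin> {W, X, P, C, V}" for a using i that by (auto simp: Inv_def)
    have ip: "m' W = i" "m' N = n" "m' H = m H" using i n same by (auto simp: Inv_def)
    have f': "m' (m H + w) = f w" if "w < n" for w using same[of "m H + w"] f[OF that] h by auto
    have "runs inst ?body m' (100 * (n + 1) + 50) (Inv (Suc i))"
    proof (rule runs_seqI[OF runs_scan[where n = n and cond = "\<lambda>y. f y \<noteq> 0"], where t' = 50])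
      fix m1 assume a: "\<And>a. a \<notin> {X, P, C} \<Longrightarrow> m1 a = m' a" and x: "m1 X < n"
      have "m1 (m H + m1 X) = f (m1 X)" using a[of "m H + m1 X"] f'[OF x] h by auto
      thus "eval inst m1 (Mem (Add (loc H) (loc X))) \<noteq> 0 \<longleftrightarrow> f (m1 X) \<noteq> 0"
        using a[of H] ip by simp
    next
      fix m1 assume m1: "(\<forall>a. a \<notin> {X, P, C} \<longrightarrow> m1 a = m' a) \<and>
        (m1 C \<noteq> 0) = (\<exists>y < n. f y \<noteq> 0 \<and> inp inst (3 + y * n + m' W) \<noteq> 0)"
      have ip1: "m1 W = i" "m1 H = m H" "m1 (m H + i) = f i" "m1 V = m' V"
        using m1 ip f'[OF i(1)] h by auto
      have "(\<exists>y < n. f y \<noteq> 0 \<and> inp inst (3 + y * n + m' W) \<noteq> 0) \<longleftrightarrow> (\<exists>y < n. f y \<noteq> 0 \<and> adj y i)"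
        using ip inp_encode(4)[of _ vs i G r k] i(1) by auto
      hence "undominated f i \<longleftrightarrow> m1 C = 0 \<and> f i = 0" using m1 i(1) by (auto simp: undominated_def)
      moreover have "m1 a = m a" if "a \<notin> {W, X, P, C, V}" for a using m1 same that by auto
      ultimately show "runs inst (Seq (Cond (Add (loc C) (Mem (Add (loc H) (loc W)))) Skip (set_loc V (loc W)))
          (set_loc W (Add (loc W) (Const 1)))) m1 50 (Inv (Suc i))"
        using ip1 i by (auto simp: Inv_def less_Suc_eq)
    qed (use ip in auto)
    thus "eval inst m' (Sub (loc N) (loc W)) \<noteq> 0 \<and> runs inst ?body m' (100 * (n + 1) + 50) (Inv (Suc i))"
      using i ip by simp
  next
    fix m' assume "Inv n m'"
    thus "eval inst m' (Sub (loc N) (loc W)) = 0 \<and> ?Q m'"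
      using n by (auto simp: Inv_def undominated_def)
  qed simp
  show ?thesis unfolding find_undominated_def runs_seq_assign
    by (intro conjI runs_mono[OF loop]) (use v in \<open>auto simp: Inv_def power2_eq_square algebra_simps\<close>)
qed

lemma runs_push_queue:
  assumes n: "m N = n" and f: "\<And>w. w < n \<Longrightarrow> m (m H + w) = f w" and h: "20 \<le> m H" "m H + n \<le> m T"
    and a: "a < 20" "a \<noteq> I" "m a < n" and q: "queue m n p \<sigma>s (m T)" "20 \<le> p"
  shows "runs x (push a) m (100 * (n + 1)) (\<lambda>m'. (\<forall>b. b \<notin> {I, T} \<and> b < m T \<longrightarrow> m' b = m b) \<and>
    queue m' n p (\<sigma>s @ [child f (m J) (m S) (m a)]) (m' T))"
proof (rule runs_mono[OF runs_push[OF n h a] order_refl])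
  fix m'
  assume m': "(\<forall>b. b \<notin> {I, T} \<and> \<not> (m T \<le> b \<and> b < m T + n + 2) \<longrightarrow> m' b = m b) \<and> m' T = m T + n + 2 \<and>
    (\<forall>w < n. m' (m T + w) = (if w = m a then m J else m (m H + w))) \<and>
    m' (m T + n) = m J \<and> m' (m T + n + 1) = m S - 1"
  hence "frame m' n (m T) (child f (m J) (m S) (m a))" using f by (auto simp: frame_def child_def)
  moreover have "queue m' n p \<sigma>s (m T)"
    by (rule queue_cong[OF q(1)]) (use m' q(2) in auto)
  ultimately show "(\<forall>b. b \<notin> {I, T} \<and> b < m T \<longrightarrow> m' b = m b) \<and>
    queue m' n p (\<sigma>s @ [child f (m J) (m S) (m a)]) (m' T)"
    using m' by (auto simp: queue_append)
qed

text \<open>Protecting the cells below the old tail suffices, since the labels of the head lie there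
  while children are appended above.\<close>

lemma runs_expand:
  assumes n: "m N = n" and f: "\<And>w. w < n \<Longrightarrow> m (m H + w) = f w"
    and h: "20 \<le> m H" "m H + n \<le> m T" and v: "m V = v" "v \<le> n" and j: "m J = j" and s: "m S = s"
  shows "runs inst expand m (400 * (n + 1)\<^sup>2) (\<lambda>m'.
    (\<forall>a. a \<notin> {T, W, X, P, C, I, OT} \<and> a < m T \<longrightarrow> m' a = m a) \<and>
    queue m' n (m T) (map (child f j s) (choices v f j)) (m' T))" (is "runs _ _ _ _ ?Q")
proof -
  define Inv where "Inv i m' \<longleftrightarrow> (\<forall>a. a \<notin> {T, W, X, P, C, I, OT} \<and> a < m T \<longrightarrow> m' a = m a) \<and> m' W = i \<and>
    m' OT = m T \<and> queue m' n (m T) (map (child f j s) (filter (cand v f j) [0..<i])) (m' T)" for i m'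
  let ?e = "Add (eq_exp (loc X) (loc V)) (eq_exp (Mem (Add (loc H) (loc X))) (loc J))"
  let ?rest = "Seq (Cond (loc C) (Cond (Mem (Add (loc H) (loc W))) Skip (push W)) Skip)
         (set_loc W (Add (loc W) (Const 1)))"
  let ?body = "Seq (scan ?e) ?rest"
  let ?fin = "Cond (Sub (loc N) (loc V))
      (Cond (eq_exp (loc T) (Add (loc OT) (Add (loc N) (Const 2)))) Skip (push V)) Skip"
  have facts: "m' N = n" "m' H = m H" "m' V = v" "m' J = j" "m' S = s"
      "\<And>w. w < n \<Longrightarrow> m' (m H + w) = f w" "m T \<le> m' T"
    if "Inv i m'" for i m'
    using that h n v j s f by (auto simp: Inv_def dest!: queue_length)
  have loop: "runs inst (While (Sub (loc N) (loc W)) ?body) m0 (n * (200 * (n + 1) + 56) + 10) (Inv n)"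
    if "Inv 0 m0" for m0
  proof (rule runs_for[where I = Inv and b = n and T = "200 * (n + 1) + 50"])
    show "Inv 0 m0" by fact
  next
    fix i m' assume i: "i < n" "Inv i m'"
    note ip = facts[OF i(2)]
    have W: "m' W = i" using i by (simp add: Inv_def)
    have "runs inst ?body m' (200 * (n + 1) + 50) (Inv (Suc i))"
    proof (rule runs_seqI[OF runs_scan[where n = n and cond = "\<lambda>y. y = v \<or> f y = j"], where t' = "100 * (n + 1) + 50"])
      fix m1 assume a: "\<And>a. a \<notin> {X, P, C} \<Longrightarrow> m1 a = m' a" and x: "m1 X < n"
      have "m1 (m H + m1 X) = f (m1 X)" using a[of "m H + m1 X"] ip(6)[OF x] h by auto
      thus "eval inst m1 ?e \<noteq> 0 \<longleftrightarrow> m1 X = v \<or> f (m1 X) = j"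
        using a[of H] a[of V] a[of J] ip(1-5) by (simp del: neq0_conv add: eq_exp_def) arith
    next
      fix m1 assume m1: "(\<forall>a. a \<notin> {X, P, C} \<longrightarrow> m1 a = m' a) \<and>
        (m1 C \<noteq> 0) = (\<exists>y < n. (y = v \<or> f y = j) \<and> inp inst (3 + y * n + m' W) \<noteq> 0)"
      have q: "queue m1 n (m T) (map (child f j s) (filter (cand v f j) [0..<i])) (m' T)"
        by (rule queue_cong[of m']) (use i m1 h in \<open>auto simp: Inv_def\<close>)
      have m1m: "\<forall>a. a \<notin> {T, W, X, P, C, I, OT} \<and> a < m T \<longrightarrow> m1 a = m a"
        using i m1 by (auto simp: Inv_def)
      have ip1: "m1 N = n" "m1 H = m H" "m1 V = v" "m1 J = j" "m1 S = s" "m1 W = i" "m1 OT = m T" "m1 T = m' T"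
        using m1 ip(1-5) W i by (auto simp: Inv_def)
      have f1: "m1 (m H + w) = f w" if "w < n" for w using m1 ip(6)[OF that] h by auto
      have "(\<exists>y < n. (y = v \<or> f y = j) \<and> inp inst (3 + y * n + m' W) \<noteq> 0) \<longleftrightarrow>
          (\<exists>y < n. (y = v \<or> f y = j) \<and> adj y i)"
        using W inp_encode(4)[of _ vs i G r k] i(1) by auto
      hence c: "cand v f j i \<longleftrightarrow> m1 C \<noteq> 0 \<and> f i = 0" using m1 by (auto simp: cand_def)
      show "runs inst ?rest m1 (100 * (n + 1) + 50) (Inv (Suc i))"
      proof (cases "cand v f j i")
        case True
        have p: "runs inst (push W) m1 (100 * (n + 1)) (\<lambda>m'. (\<forall>b. b \<notin> {I, T} \<and> b < m1 T \<longrightarrow> m' b = m1 b) \<and>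
          queue m' n (m T) (map (child f j s) (filter (cand v f j) [0..<i]) @ [child f (m1 J) (m1 S) (m1 W)]) (m' T))"
          by (rule runs_push_queue) (use ip1 f1 h i q ip in auto)
        have "runs inst (Seq (push W) (set_loc W (Add (loc W) (Const 1)))) m1 (100 * (n + 1) + 10) (Inv (Suc i))"
        proof (rule runs_seqI[OF p, where t' = 10])
          fix m2 assume m2: "(\<forall>b. b \<notin> {I, T} \<and> b < m1 T \<longrightarrow> m2 b = m1 b) \<and>
            queue m2 n (m T) (map (child f j s) (filter (cand v f j) [0..<i]) @ [child f (m1 J) (m1 S) (m1 W)]) (m2 T)"
          have "queue (m2(W := Suc i)) n (m T) (map (child f j s) (filter (cand v f j) [0..<Suc i])) (m2 T)"
            by (rule queue_cong[of m2]) (use m2 True ip1 h in auto)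
          moreover have "m2 W = i" "m2 OT = m T" using m2 ip1 ip h by auto
          moreover have "m2 a = m a" if "a \<notin> {T, W, X, P, C, I, OT}" "a < m T" for a
            using m2 m1m that ip1 ip(7) by auto
          ultimately show "runs inst (set_loc W (Add (loc W) (Const 1))) m2 10 (Inv (Suc i))"
            by (simp add: Inv_def)
        qed simp
        hence "runs inst (Seq (push W) (set_loc W (Add (loc W) (Const 1)))) m1 T' (Inv (Suc i))"
          if "100 * (n + 1) + 10 \<le> T'" for T' using that by (blast intro: runs_mono)
        thus ?thesis using True c ip1 f1[OF i(1)] by simp
      next
        case False
        have "queue (m1(W := Suc i)) n (m T) (map (child f j s) (filter (cand v f j) [0..<Suc i])) (m1 T)"
          by (rule queue_cong[of m1]) (use q ip1 False h in auto)
        hence "Inv (Suc i) (m1(W := Suc i))" using m1m ip1 by (simp add: Inv_def)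
        thus ?thesis using False c ip1 f1[OF i(1)] by auto
      qed
    qed (use ip in auto)
    thus "eval inst m' (Sub (loc N) (loc W)) \<noteq> 0 \<and> runs inst ?body m' (200 * (n + 1) + 50) (Inv (Suc i))"
      using i W ip by simp
  next
    fix m' assume I: "Inv n m'"
    thus "eval inst m' (Sub (loc N) (loc W)) = 0 \<and> Inv n m'" using facts(1)[OF I] by (simp add: Inv_def)
  qed simp
  have fin: "runs inst ?fin m1 (100 * (n + 1) + 50) ?Q" if I: "Inv n m1" for m1
  proof -
    let ?ws = "filter (cand v f j) [0..<n]"
    note ip = facts[OF I]
    have q: "queue m1 n (m T) (map (child f j s) ?ws) (m1 T)" "m1 OT = m T" using I by (auto simp: Inv_def)
    have len: "m1 T = m T + length ?ws * (n + 2)" using queue_length[OF q(1)] by simp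
    have eq: "m1 T = m T + (n + 2) \<longleftrightarrow> length ?ws = 1"
      using len mult_cancel2[of "length ?ws" "n + 2" 1] by auto
    show ?thesis
    proof (cases "v < n \<and> length ?ws \<noteq> 1")
      case True
      have p: "runs inst (push V) m1 (100 * (n + 1)) (\<lambda>m'. (\<forall>b. b \<notin> {I, T} \<and> b < m1 T \<longrightarrow> m' b = m1 b) \<and>
          queue m' n (m T) (map (child f j s) ?ws @ [child f (m1 J) (m1 S) (m1 V)]) (m' T))"
        by (rule runs_push_queue) (use ip h q True in auto)
      have p': "runs inst (push V) m1 T' ?Q" if "100 * (n + 1) \<le> T'" for T'
      proof (rule runs_mono[OF p that])
        fix m2 assume m2: "(\<forall>b. b \<notin> {I, T} \<and> b < m1 T \<longrightarrow> m2 b = m1 b) \<and>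
          queue m2 n (m T) (map (child f j s) ?ws @ [child f (m1 J) (m1 S) (m1 V)]) (m2 T)"
        have "m2 a = m a" if "a \<notin> {T, W, X, P, C, I, OT}" "a < m T" for a
          using m2 that I ip(7) by (auto simp: Inv_def)
        moreover have "map (child f j s) (choices v f j) = map (child f j s) ?ws @ [child f (m1 J) (m1 S) (m1 V)]"
          using True ip by (simp add: choices_def)
        ultimately show "?Q m2" using m2 by metis
      qed
      show ?thesis using True eq ip q p' by (simp del: neq0_conv)
    next
      case False
      have "?Q m1" using I False by (auto simp: Inv_def choices_def Let_def)
      thus ?thesis using False eq ip q by (auto simp del: neq0_conv)
    qed
  qed
  show ?thesis unfolding expand_def runs_seq_assign
  proof (intro conjI runs_seqI[OF loop _ fin])
    show "Inv 0 (m(eval inst m (Const OT) := eval inst m (loc T),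
        eval inst (m(eval inst m (Const OT) := eval inst m (loc T))) (Const W) :=
        eval inst (m(eval inst m (Const OT) := eval inst m (loc T))) (Const 0)))"
      using h by (auto simp: Inv_def)
  qed (auto simp: power2_eq_square algebra_simps)
qed

text \<open>The labels of the head are required to lie below the tail only if children are produced;
  after acceptance the tail equals the head.\<close>

lemma runs_process_tail:
  assumes n: "m N = n" and f: "\<And>w. w < n \<Longrightarrow> m (m H + w) = f w"
    and h: "20 \<le> m H" "20 \<le> m T" and v: "m V = v" "v \<le> n" and j: "m J = j" and s: "m S = s"
    and t: "s \<noteq> 0 \<Longrightarrow> m H + n \<le> m T"
  shows "runs inst process_tail m (500 * (n + 1)\<^sup>2) (\<lambda>m'.
    (\<forall>a. a \<notin> {H, T, W, X, P, C, I, OT} \<and> a < m T \<longrightarrow> m' a = m a) \<and> m' H = m H + n + 2 \<and>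
    (if s = 0 then m' T = m T else queue m' n (m T) (map (child f j s) (choices v f j)) (m' T)))"
    (is "runs _ _ _ _ ?Q")
proof (cases "s = 0")
  case True
  have "runs inst process_tail m 30 ?Q" using True n s by (simp add: process_tail_def)
  thus ?thesis by (rule runs_mono) (simp_all add: power2_eq_square)
next
  case False
  have "runs inst (Seq expand (set_loc H (Add (loc H) (Add (loc N) (Const 2))))) m (400 * (n + 1)\<^sup>2 + 10) ?Q"
  proof (rule runs_seqI[OF runs_expand[OF n f h(1) t[OF False] v j s], where t' = 10])
    fix m' assume m': "(\<forall>a. a \<notin> {T, W, X, P, C, I, OT} \<and> a < m T \<longrightarrow> m' a = m a) \<and>
      queue m' n (m T) (map (child f j s) (choices v f j)) (m' T)"
    have "m' H = m H" "m' N = n" using m' h n by auto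
    moreover have "queue (m'(H := m H + n + 2)) n (m T) (map (child f j s) (choices v f j)) (m' T)"
      by (rule queue_cong[of m']) (use m' h in auto)
    ultimately show "runs inst (set_loc H (Add (loc H) (Add (loc N) (Const 2)))) m' 10 ?Q"
      using m' False by (simp add: add.assoc)
  qed simp_all
  hence "runs inst (Seq expand (set_loc H (Add (loc H) (Add (loc N) (Const 2))))) m T' ?Q"
    if "400 * (n + 1)\<^sup>2 + 10 \<le> T'" for T' using that by (rule runs_mono)
  moreover have "400 * (n + 1)\<^sup>2 + 10 + 3 \<le> 500 * (n + 1)\<^sup>2" by (simp add: power2_eq_square)
  ultimately show ?thesis unfolding process_tail_def runs_seq_cond using False s by simp
qed

text \<open>The case of no children.\<close>

lemma potential_pos: "potential \<sigma> > 0"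
proof (cases \<sigma>)
  case (fields f j s)
  thus ?thesis using potential_children[of "[]" f 0 0 j s] by simp
qed

lemma runs_process_head:
  assumes m: "m N = n" "m R = r" "m K = k" "m ANS = 0" "20 \<le> m H"
    and q: "queue m n (m H) (\<sigma> # \<sigma>s) (m T)" and V: "valid \<sigma>"
  shows "runs inst process_head m (800 * (n + 1)\<^sup>2) (\<lambda>m'.
    m' N = n \<and> m' R = r \<and> m' K = k \<and> 20 \<le> m' H \<and>
    (m' ANS = 0 \<and> (\<exists>cs. queue m' n (m' H) (\<sigma>s @ cs) (m' T) \<and> (\<forall>c \<in> set cs. valid c) \<and>
       (\<Sum>c \<leftarrow> cs. potential c) < potential \<sigma> \<and> (good \<sigma> \<longrightarrow> (\<exists>c \<in> set cs. good c))) \<or>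
     m' ANS = 1 \<and> r_grouped_dominating_set_problem G r k \<and> m' T \<le> m' H))"
    (is "runs _ _ _ _ ?Q")
proof -
  obtain f j s where \<sigma>: "\<sigma> = (f, j, s)" by (cases \<sigma>)
  have fr: "\<And>w. w < n \<Longrightarrow> m (m H + w) = f w" "m (m H + n) = j" "m (m H + (n + 1)) = s"
    and qs: "queue m n (m H + n + 2) \<sigma>s (m T)"
    using q by (auto simp: \<sigma> frame_def)
  have t: "m H + n + 2 \<le> m T" using queue_length[OF qs] by simp
  define m1 where "m1 = m(J := j, S := s, V := n)"
  have m1: "m1 a = m a" if "a \<notin> {J, S, V}" for a using that by (simp add: m1_def)
  have m1': "m1 J = j" "m1 S = s" "m1 V = n" by (simp_all add: m1_def)
  define mid where "mid = Seq find_undominated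
       (Cond (Sub (loc N) (loc V))
         (Cond (Sub (loc K) (loc J)) (Seq (set_loc J (Add (loc J) (Const 1))) (set_loc S (loc R))) Skip)
         (Seq (set_loc ANS (Const 1)) (set_loc T (loc H))))"
  \<comment> \<open>All outcomes meet here: \<open>c\<close> covers children from growing or
    starting a unit, rejection of a state that is not good, and acceptance.\<close>
  have tail: "runs inst process_tail m2 (500 * (n + 1)\<^sup>2) ?Q"
    if m2: "\<And>a. a \<notin> {W, X, P, C, V, J, S, ANS, T} \<Longrightarrow> m2 a = m a" and v: "m2 V \<le> n"
      and c: "m2 ANS = 0 \<and> m2 T = m T \<and>
          (if m2 S = 0 then \<not> good \<sigma> else
            (let cs = map (child f (m2 J) (m2 S)) (choices (m2 V) f (m2 J)) in (\<forall>c \<in> set cs. valid c) \<and>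
       (\<Sum>c \<leftarrow> cs. potential c) < potential \<sigma> \<and> (good \<sigma> \<longrightarrow> (\<exists>c \<in> set cs. good c))))
        \<or> m2 ANS = 1 \<and> m2 T = m H \<and> m2 S = 0 \<and> r_grouped_dominating_set_problem G r k" for m2
  proof (rule runs_mono[OF runs_process_tail[where f = f and v = "m2 V" and j = "m2 J" and s = "m2 S"] order_refl])
    show "m2 N = n" "m2 V \<le> n" "20 \<le> m2 H" using m2 m v by auto
    show "20 \<le> m2 T" using c m t by auto
    show "m2 (m2 H + w) = f w" if "w < n" for w using fr(1)[OF that] m m2 by auto
    show "m2 H + n \<le> m2 T" if "m2 S \<noteq> 0" using c that t m2 by auto
    fix m' assume m': "(\<forall>a. a \<notin> {H, T, W, X, P, C, I, OT} \<and> a < m2 T \<longrightarrow> m' a = m2 a) \<and> m' H = m2 H + n + 2 \<and>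
      (if m2 S = 0 then m' T = m2 T else
        queue m' n (m2 T) (map (child f (m2 J) (m2 S)) (choices (m2 V) f (m2 J))) (m' T))"
    have t2: "20 \<le> m2 T" using c m t by auto
    have eqs: "m' N = n" "m' R = r" "m' K = k" "m' ANS = m2 ANS" "m' H = m H + n + 2"
      using m' m2 m t2 by auto
    show "?Q m'"
    proof (cases "m2 ANS = 1")
      case True
      thus ?thesis using c eqs m m' by auto
    next
      case False
      hence c': "m2 ANS = 0" "m2 T = m T" using c by auto
      have old: "queue m' n (m' H) \<sigma>s (m T)" unfolding eqs(5)
        by (rule queue_cong[OF qs]) (use m' m2 m c' in auto)
      show ?thesis
      proof (cases "m2 S = 0")
        case True
        thus ?thesis using old c c' eqs m m' potential_pos[of \<sigma>] by (auto intro!: exI[of _ "[]"])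
      next
        case S: False
        let ?cs = "map (child f (m2 J) (m2 S)) (choices (m2 V) f (m2 J))"
        have "queue m' n (m' H) (\<sigma>s @ ?cs) (m' T)" using old m' S c' by (auto simp: queue_append)
        thus ?thesis using c c' eqs m S unfolding Let_def by (auto intro!: exI[of _ ?cs])
      qed
    qed
  qed auto
  have mid: "runs inst (Seq mid process_tail) m1 (750 * (n + 1)\<^sup>2) ?Q" if s: "s = 0"
    unfolding mid_def runs_seq_assoc
  proof (rule runs_seqI[OF runs_find_undominated[of m1 f], where t' = "500 * (n + 1)\<^sup>2 + 50"])
    show "m1 (m1 H + w) = f w" if "w < n" for w using fr(1)[OF that] m m1 by auto
    fix m2 assume m2: "(\<forall>a. a \<notin> {W, X, P, C, V} \<longrightarrow> m2 a = m1 a) \<and>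
      (undominated f (m2 V) \<or> m2 V = n \<and> (\<nexists>v. undominated f v))"
    have ip: "m2 N = n" "m2 R = r" "m2 K = k" "m2 ANS = 0" "m2 J = j" "m2 S = 0" "m2 H = m H" "m2 T = m T"
      using m2 m1 m1' m s by auto
    have same: "m2 a = m a" if "a \<notin> {W, X, P, C, V, J, S}" for a using m2 m1 that by auto
    have V0: "valid (f, j, 0)" using V \<sigma> s by simp
    consider (start) "undominated f (m2 V)" "j < k" | (full) "undominated f (m2 V)" "\<not> j < k"
      | (accept) "m2 V = n" "\<nexists>v. undominated f v" using m2 by blast
    thus "runs inst (Seq (Cond (Sub (loc N) (loc V))
         (Cond (Sub (loc K) (loc J)) (Seq (set_loc J (Add (loc J) (Const 1))) (set_loc S (loc R))) Skip)
         (Seq (set_loc ANS (Const 1)) (set_loc T (loc H)))) process_tail) m2 (500 * (n + 1)\<^sup>2 + 50) ?Q"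
    proof cases
      case start
      have "runs inst process_tail (m2(J := Suc j, S := r)) (500 * (n + 1)\<^sup>2) ?Q"
        by (rule tail) (use same ip r_pos start children_start[OF V0 start] in
          \<open>auto simp: undominated_def \<sigma> s Let_def\<close>)
      hence "runs inst process_tail (m2(J := Suc j, S := r)) T' ?Q" if "500 * (n + 1)\<^sup>2 \<le> T'" for T'
        using that by (rule runs_mono)
      thus ?thesis using start ip by (simp add: undominated_def)
    next
      case full
      \<comment> \<open>A good state with an undominated vertex would have \<open>j < k\<close>, so
        dropping this one loses no solution.\<close>
      have "\<not> good \<sigma>" using good_start(1)[OF V0 full(1)] full(2) \<sigma> s by auto
      hence "runs inst process_tail m2 (500 * (n + 1)\<^sup>2) ?Q"
        by (intro tail) (use same ip full in \<open>auto simp: undominated_def\<close>)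
      hence "runs inst process_tail m2 T' ?Q" if "500 * (n + 1)\<^sup>2 \<le> T'" for T'
        using that by (rule runs_mono)
      thus ?thesis using full ip by (simp add: undominated_def)
    next
      case accept
      have "runs inst process_tail (m2(ANS := 1, T := m H)) (500 * (n + 1)\<^sup>2) ?Q"
        by (rule tail) (use same ip accept accept_sound[OF V0 accept(2)] in auto)
      hence "runs inst process_tail (m2(ANS := 1, T := m H)) T' ?Q" if "500 * (n + 1)\<^sup>2 \<le> T'" for T'
        using that by (rule runs_mono)
      thus ?thesis using accept ip by simp
    qed
  qed (use m m1 m1' in \<open>auto simp: power2_eq_square\<close>)
  have rest: "runs inst (Seq (Cond (loc S) Skip mid) process_tail) m1 (750 * (n + 1)\<^sup>2 + 10) ?Q"
  proof (cases "s = 0")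
    case True
    have "runs inst (Seq mid process_tail) m1 T' ?Q" if "750 * (n + 1)\<^sup>2 \<le> T'" for T'
      using mid[OF True] that by (rule runs_mono)
    thus ?thesis using True m1' by simp
  next
    case False
    have "runs inst process_tail m1 (500 * (n + 1)\<^sup>2) ?Q"
      by (rule tail) (use m1 m1' m False children_grow[of f j s] V in \<open>auto simp: \<sigma> Let_def\<close>)
    hence "runs inst process_tail m1 T' ?Q" if "500 * (n + 1)\<^sup>2 \<le> T'" for T'
      using that by (rule runs_mono)
    thus ?thesis using False m1' by simp
  qed
  define rest_prog where "rest_prog = Seq (Cond (loc S) Skip mid) process_tail"
  define rest_time where "rest_time = 750 * (n + 1)\<^sup>2 + 10"
  have rest': "runs inst rest_prog m1 T' ?Q" if "rest_time \<le> T'" for T'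
    using rest that unfolding rest_prog_def rest_time_def by (rule runs_mono)
  have "runs inst (Seq (set_loc J (Mem (Add (loc H) (loc N))))
     (Seq (set_loc S (Mem (Add (loc H) (Add (loc N) (Const 1)))))
     (Seq (set_loc V (loc N)) rest_prog))) m (30 + rest_time) ?Q"
    using fr(2,3) m rest'[unfolded m1_def] by simp
  moreover have "30 + rest_time \<le> 800 * (n + 1)\<^sup>2" by (simp add: rest_time_def power2_eq_square)
  ultimately show ?thesis
    unfolding process_head_def rest_prog_def mid_def process_tail_def by (rule runs_mono)
qed

text \<open>The total potential of the queue drops in every iteration and so bounds their number. A
  solvable instance keeps a good state queued until acceptance, so an emptied queue means
  no.\<close>

lemma runs_solver:
  "runs inst solver (\<lambda>_. 0) (1000 * (n + 1) ^ 3 * \<Delta> ^ (2 * (k * r\<^sup>2)))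
     (\<lambda>m. m ANS \<noteq> 0 \<longleftrightarrow> r_grouped_dominating_set_problem G r k)"
proof -
  let ?pr = "r_grouped_dominating_set_problem G r k"
  define Inv where "Inv p m \<longleftrightarrow> m N = n \<and> m R = r \<and> m K = k \<and> 20 \<le> m H \<and>
    (m ANS = 0 \<and> (\<exists>\<sigma>s. queue m n (m H) \<sigma>s (m T) \<and> (\<forall>\<sigma> \<in> set \<sigma>s. valid \<sigma>) \<and>
       (\<Sum>\<sigma> \<leftarrow> \<sigma>s. potential \<sigma>) = p \<and> (?pr \<longrightarrow> (\<exists>\<sigma> \<in> set \<sigma>s. good \<sigma>))) \<or>
     m ANS = 1 \<and> ?pr \<and> m T \<le> m H)" for p m
  let ?p = "potential (\<lambda>_. 0, 0, 0)"
  have loop: "runs inst (While (Sub (loc T) (loc H)) process_head) m0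
      (?p * (800 * (n + 1)\<^sup>2 + 6) + 6) (\<lambda>m. m ANS \<noteq> 0 \<longleftrightarrow> ?pr)" if "Inv ?p m0" for m0
  proof (rule runs_while[where I = Inv and T = "800 * (n + 1)\<^sup>2"])
    show "Inv ?p m0" by fact
  next
    fix p m assume I: "Inv p m" "eval inst m (Sub (loc T) (loc H)) \<noteq> 0"
    have gt: "m H < m T" using I(2) by simp
    then obtain \<tau>s where \<tau>s: "m ANS = 0" "queue m n (m H) \<tau>s (m T)" "\<forall>\<sigma> \<in> set \<tau>s. valid \<sigma>"
      "(\<Sum>\<sigma> \<leftarrow> \<tau>s. potential \<sigma>) = p" "?pr \<longrightarrow> (\<exists>\<sigma> \<in> set \<tau>s. good \<sigma>)"
      using I(1) unfolding Inv_def by auto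
    then obtain \<sigma> \<sigma>s where c: "\<tau>s = \<sigma> # \<sigma>s" using gt by (cases \<tau>s) auto
    show "runs inst process_head m (800 * (n + 1)\<^sup>2) (\<lambda>m'. \<exists>q < p. Inv q m')"
    proof (rule runs_mono[OF runs_process_head[of m \<sigma> \<sigma>s] order_refl])
      fix m' assume m': "m' N = n \<and> m' R = r \<and> m' K = k \<and> 20 \<le> m' H \<and>
        (m' ANS = 0 \<and> (\<exists>cs. queue m' n (m' H) (\<sigma>s @ cs) (m' T) \<and> (\<forall>c \<in> set cs. valid c) \<and>
           (\<Sum>c \<leftarrow> cs. potential c) < potential \<sigma> \<and> (good \<sigma> \<longrightarrow> (\<exists>c \<in> set cs. good c))) \<or>
         m' ANS = 1 \<and> ?pr \<and> m' T \<le> m' H)"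
      show "\<exists>q < p. Inv q m'"
      proof (cases "m' ANS = 1")
        case True
        \<comment> \<open>After acceptance the invariant holds for any variant, so 0 is chosen; the
          head's potential makes this a decrease.\<close>
        have "p > 0" using \<tau>s(4) c potential_pos[of \<sigma>] by simp
        moreover have "Inv 0 m'" using m' True by (simp add: Inv_def)
        ultimately show ?thesis by blast
      next
        case False
        then obtain cs where cs: "queue m' n (m' H) (\<sigma>s @ cs) (m' T)" "\<forall>c \<in> set cs. valid c"
           "(\<Sum>c \<leftarrow> cs. potential c) < potential \<sigma>" "good \<sigma> \<longrightarrow> (\<exists>c \<in> set cs. good c)" "m' ANS = 0"
          using m' by auto
        let ?q = "\<Sum>\<sigma> \<leftarrow> \<sigma>s @ cs. potential \<sigma>"
        have "?q < p" using cs(3) \<tau>s(4) c by simp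
        moreover have "Inv ?q m'" unfolding Inv_def
          using m' cs \<tau>s(3,5) c by (intro conjI disjI1 exI[of _ "\<sigma>s @ cs"]) auto
        ultimately show ?thesis by blast
      qed
    qed (use I(1) \<tau>s c in \<open>auto simp: Inv_def\<close>)
  next
    fix p m assume I: "Inv p m" "eval inst m (Sub (loc T) (loc H)) = 0"
    have le: "m T \<le> m H" using I(2) by simp
    show "m ANS \<noteq> 0 \<longleftrightarrow> ?pr"
    proof (cases "m ANS = 0")
      case True
      then obtain \<tau>s where \<tau>s: "queue m n (m H) \<tau>s (m T)" "?pr \<longrightarrow> (\<exists>\<sigma> \<in> set \<tau>s. good \<sigma>)"
        using I(1) unfolding Inv_def by auto
      have "\<tau>s = []" using queue_length[OF \<tau>s(1)] le by simp
      thus ?thesis using True \<tau>s(2) by simp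
    qed (use I in \<open>auto simp: Inv_def\<close>)
  qed (simp add: algebra_simps)
  let ?m = "(\<lambda>_. 0)(N := n, R := r, K := k, H := 20, T := 22 + n)"
  have "Inv ?p ?m"
    unfolding Inv_def
    using valid_initial good_initial
    by (intro conjI disjI1 exI[of _ "[(\<lambda>_. 0, 0, 0)]"]) (auto simp: frame_def)
  note loop_run = loop[OF this]
  define loop_time where "loop_time = ?p * (800 * (n + 1)\<^sup>2 + 6) + 6"
  have loop': "runs inst (While (Sub (loc T) (loc H)) process_head) ?m T' (\<lambda>m. m ANS \<noteq> 0 \<longleftrightarrow> ?pr)"
    if "loop_time \<le> T'" for T'
    using loop_run that unfolding loop_time_def by (rule runs_mono)
  let ?D = "\<Delta> ^ (2 * (k * r\<^sup>2))"
  have D: "?D \<ge> 1" by simp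
  \<comment> \<open>The two 6s pay for loop tests and 40 for the initial assignments. One factor
    \<open>n + 1\<close> counts levels, the other two are the time per state.\<close>
  have "?p * (800 * (n + 1)\<^sup>2 + 6) + 46 \<le> ((n + 1) * ?D) * (850 * (n + 1)\<^sup>2) + 46"
    using potential_initial by (intro add_mono mult_mono) (auto simp: power2_eq_square)
  also have "\<dots> = 850 * (n + 1) ^ 3 * ?D + 46" by (simp add: power2_eq_square power3_eq_cube algebra_simps)
  also have "\<dots> \<le> 850 * (n + 1) ^ 3 * ?D + 150 * ((n + 1) ^ 3 * ?D)"
  proof -
    have "1 \<le> (n + 1) ^ 3 * ?D" using D by (metis One_nat_def Suc_eq_plus1 mult_is_0 not_less_eq_eq power_not_zero le_zero_eq nat.simps(3) not_one_le_zero)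
    thus ?thesis by linarith
  qed
  also have "\<dots> = 1000 * (n + 1) ^ 3 * ?D" by (simp add: mult_ac)
  finally have T: "?p * (800 * (n + 1)\<^sup>2 + 6) + 6 + 40 \<le> 1000 * (n + 1) ^ 3 * ?D" by simp
  have "runs inst solver (\<lambda>_. 0) (40 + loop_time) (\<lambda>m. m ANS \<noteq> 0 \<longleftrightarrow> ?pr)"
    unfolding solver_def using loop' inp_encode(1-3)[of G vs r k] by simp
  thus ?thesis by (rule runs_mono) (use T in \<open>simp_all add: loop_time_def\<close>)
qed

end

lemma length_le_input_size: "length x \<le> input_size x"
  by (induction x) (auto simp: input_size_def)

theorem theorem5:
  shows "\<exists>c (A::nat) (B::nat) (d::nat).
    \<forall>(G :: nat pair_pre_digraph) (vs :: nat list) (r::nat) (k::nat).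
      pair_graph G \<longrightarrow> distinct vs \<longrightarrow> set vs = pverts G \<longrightarrow> r > 0 \<longrightarrow> k > 0 \<longrightarrow>
      decides_within c (encode G vs r k)
        (r_grouped_dominating_set_problem G r k)
        (B * input_size (encode G vs r k) ^ d * max 1 (max_degree G) ^ (A * (k * r\<^sup>2)))"
proof (rule exI[of _ solver], rule exI[of _ 2], rule exI[of _ 1000], rule exI[of _ 3], intro allI impI)
  fix G :: "nat pair_pre_digraph" and vs :: "nat list" and r k :: nat
  assume "pair_graph G" "distinct vs" "set vs = pverts G" "r > 0" "k > 0"
  then interpret unit_search G vs r k by (simp add: unit_search_def unit_search_axioms_def)
  let ?s = "input_size (encode G vs r k)"
  \<comment> \<open>The matrix entries and three header words already number at least
    \<open>n + 1\<close>, and each word has size at least 1.\<close>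
  have "n \<le> n * n" by (rule le_square)
  hence "n + 1 \<le> length (encode G vs r k)" unfolding length_encode by linarith
  hence "n + 1 \<le> ?s" using length_le_input_size le_trans by blast
  hence le: "1000 * (n + 1) ^ 3 * max 1 (max_degree G) ^ (2 * (k * r\<^sup>2))
      \<le> 1000 * ?s ^ 3 * max 1 (max_degree G) ^ (2 * (k * r\<^sup>2))"
    by (intro mult_le_mono power_mono) auto
  have "runs (encode G vs r k) solver (\<lambda>_. 0) (1000 * ?s ^ 3 * max 1 (max_degree G) ^ (2 * (k * r\<^sup>2)))
      (\<lambda>m. m 0 \<noteq> 0 \<longleftrightarrow> r_grouped_dominating_set_problem G r k)"
    by (rule runs_mono[OF runs_solver le])
  thus "decides_within solver (encode G vs r k) (r_grouped_dominating_set_problem G r k)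
      (1000 * ?s ^ 3 * max 1 (max_degree G) ^ (2 * (k * r\<^sup>2)))"
    unfolding runs_def decides_within_def by blast
qed

end
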